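(* Let $\mathcal{A}$ be a category, let $\mathcal{F} \colon \mathcal{A}^{\mathrm{op}} \to \mathsf{CAT}$ be a pseudofunctor, and let $U \colon \int_{\mathcal{A}} \mathcal{F} \to \mathcal{A}$ be its Grothendieck construction. If the category $\mathcal{F}_a$ has a strict initial object $\mathsf{0}_a$ for each object $a$ of $\mathcal{A}$, and for each morphism $f \colon a \to b$ of $\mathcal{A}$ the functor $\mathcal{F}_f \colon \mathcal{F}_b \to \mathcal{F}_a$ preserves initial objects, then $U$ preserves effective descent morphisms.
   Context: $\mathsf{CAT}$ is the 2-category of (possibly large) categories. The Grothendieck construction of a pseudofunctor $\mathcal{F} \colon \mathcal{A}^{\mathrm{op}} \to \mathsf{CAT}$ is the projection (fibration) $\int_{\mathcal{A}} \mathcal{F} \to \mathcal{A}$, $(a,x)\mapsto a$, where $\int_{\mathcal{A}} \mathcal{F}$ has as objects the pairs $(a,x)$ with $a$ an object of $\mathcal{A}$ and $x$ an object of $\mathcal{F}_a$, and as morphisms $(a,x)\to(b,y)$ the pairs $(f,\phi)$ with $f \colon a \to b$ in $\mathcal{A}$ and $\phi \colon x \to \mathcal{F}_f(y)$ in $\mathcal{F}_a$, with the usual composition. An initial object $\mathsf{0}$ of a category is strict if every object $x$ admitting a morphism $x \to \mathsf{0}$ is isomorphic to $\mathsf{0}$. A morphism $p \colon a \to b$ in a category $\mathcal{X}$ is an effective descent morphism if all pullbacks along $p$ exist in $\mathcal{X}$ (equivalently, the functor $p_! \colon \mathcal{X} \downarrow a \to \mathcal{X} \downarrow b$, $f \mapsto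 p \circ f$, between slice categories has a right adjoint $p^*$) and $p^*$ is monadic (its comparison functor into the Eilenberg-Moore category of the monad induced by $p_! \dashv p^*$ is an equivalence). No existence of other pullbacks in $\mathcal{X}$ is assumed. A functor $F$ preserves effective descent morphisms if $F(p)$ is an effective descent morphism whenever $p$ is. *)

theory Defs
  imports Main
begin

section \<open>Categories, functors, natural transformations\<close>

record ('o, 'm) cat =
  Obj :: "'o set"
  Arr :: "'m set"
  Dom :: "'m \<Rightarrow> 'o"
  Cod :: "'m \<Rightarrow> 'o"
  Ident :: "'o \<Rightarrow> 'm"
  Compose :: "'m \<Rightarrow> 'm \<Rightarrow> 'm"  (infixr "\<cdot>\<index>" 70)

definition Hom :: "('o, 'm) cat \<Rightarrow> 'o \<Rightarrow> 'o \<Rightarrow> 'm set" where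
  "Hom C x y = {f \<in> Arr C. Dom C f = x \<and> Cod C f = y}"

locale category =
  fixes C :: "('o, 'm) cat"
  assumes Dom_in: "f \<in> Arr C \<Longrightarrow> Dom C f \<in> Obj C"
    and Cod_in: "f \<in> Arr C \<Longrightarrow> Cod C f \<in> Obj C"
    and Ident_in: "x \<in> Obj C \<Longrightarrow> Ident C x \<in> Hom C x x"
    and Compose_in: "f \<in> Hom C x y \<Longrightarrow> g \<in> Hom C y z \<Longrightarrow> g \<cdot>\<^bsub>C\<^esub> f \<in> Hom C x z"
    and Ident_right: "f \<in> Hom C x y \<Longrightarrow> f \<cdot>\<^bsub>C\<^esub> Ident C x = f"
    and Ident_left: "f \<in> Hom C x y \<Longrightarrow> Ident C y \<cdot>\<^bsub>C\<^esub> f = f"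
    and Compose_assoc: "f \<in> Hom C w x \<Longrightarrow> g \<in> Hom C x y \<Longrightarrow> h \<in> Hom C y z \<Longrightarrow>
      (h \<cdot>\<^bsub>C\<^esub> g) \<cdot>\<^bsub>C\<^esub> f = h \<cdot>\<^bsub>C\<^esub> (g \<cdot>\<^bsub>C\<^esub> f)"

definition iso_arrow :: "('o, 'm) cat \<Rightarrow> 'm \<Rightarrow> bool" where
  "iso_arrow C f \<longleftrightarrow> f \<in> Arr C \<and> (\<exists>g \<in> Hom C (Cod C f) (Dom C f).
     g \<cdot>\<^bsub>C\<^esub> f = Ident C (Dom C f) \<and> f \<cdot>\<^bsub>C\<^esub> g = Ident C (Cod C f))"

definition isomorphic :: "('o, 'm) cat \<Rightarrow> 'o \<Rightarrow> 'o \<Rightarrow> bool" where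
  "isomorphic C x y \<longleftrightarrow> (\<exists>f \<in> Hom C x y. iso_arrow C f)"

definition initial :: "('o, 'm) cat \<Rightarrow> 'o \<Rightarrow> bool" where
  "initial C z \<longleftrightarrow> z \<in> Obj C \<and> (\<forall>x \<in> Obj C. \<exists>!f. f \<in> Hom C z x)"

definition strict_initial :: "('o, 'm) cat \<Rightarrow> 'o \<Rightarrow> bool" where
  "strict_initial C z \<longleftrightarrow>
     initial C z \<and> (\<forall>x \<in> Obj C. Hom C x z \<noteq> {} \<longrightarrow> isomorphic C x z)"

record ('o, 'm, 'p, 'n) fctr =
  omap :: "'o \<Rightarrow> 'p"
  amap :: "'m \<Rightarrow> 'n"

definition fctr_id :: "('o, 'm, 'o, 'm) fctr" where
  "fctr_id = \<lparr>omap = (\<lambda>x. x), amap = (\<lambda>f. f)\<rparr>"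

definition fctr_comp ::
  "('p, 'n, 'q, 'l) fctr \<Rightarrow> ('o, 'm, 'p, 'n) fctr \<Rightarrow> ('o, 'm, 'q, 'l) fctr"  (infixr "\<circ>\<^sub>F" 75) where
  "G \<circ>\<^sub>F F = \<lparr>omap = omap G \<circ> omap F, amap = amap G \<circ> amap F\<rparr>"

locale is_functor =
  C: category C + D: category D
  for C :: "('o, 'm) cat" and D :: "('p, 'n) cat" +
  fixes F :: "('o, 'm, 'p, 'n) fctr"
  assumes omap_in: "x \<in> Obj C \<Longrightarrow> omap F x \<in> Obj D"
    and amap_in: "f \<in> Hom C x y \<Longrightarrow> amap F f \<in> Hom D (omap F x) (omap F y)"
    and amap_Ident: "x \<in> Obj C \<Longrightarrow> amap F (Ident C x) = Ident D (omap F x)"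
    and amap_Compose: "f \<in> Hom C x y \<Longrightarrow> g \<in> Hom C y z \<Longrightarrow>
      amap F (g \<cdot>\<^bsub>C\<^esub> f) = amap F g \<cdot>\<^bsub>D\<^esub> amap F f"

definition preserves_initial_objects ::
  "('o, 'm) cat \<Rightarrow> ('p, 'n) cat \<Rightarrow> ('o, 'm, 'p, 'n) fctr \<Rightarrow> bool" where
  "preserves_initial_objects C D F \<longleftrightarrow> (\<forall>z. initial C z \<longrightarrow> initial D (omap F z))"

locale nat_trans =
  F: is_functor C D F + G: is_functor C D G
  for C :: "('o, 'm) cat" and D :: "('p, 'n) cat" and F G +
  fixes \<tau> :: "'o \<Rightarrow> 'n"
  assumes component_in: "x \<in> Obj C \<Longrightarrow> \<tau> x \<in> Hom D (omap F x) (omap G x)"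
    and naturality: "f \<in> Hom C x y \<Longrightarrow> amap G f \<cdot>\<^bsub>D\<^esub> \<tau> x = \<tau> y \<cdot>\<^bsub>D\<^esub> amap F f"

locale nat_iso = nat_trans +
  assumes component_iso: "x \<in> Obj C \<Longrightarrow> iso_arrow D (\<tau> x)"

definition is_equivalence ::
  "('o, 'm) cat \<Rightarrow> ('p, 'n) cat \<Rightarrow> ('o, 'm, 'p, 'n) fctr \<Rightarrow> bool" where
  "is_equivalence C D F \<longleftrightarrow> is_functor C D F \<and>
     (\<exists>G \<sigma> \<tau>. is_functor D C G \<and>
        nat_iso C C fctr_id (G \<circ>\<^sub>F F) \<sigma> \<and> nat_iso D D (F \<circ>\<^sub>F G) fctr_id \<tau>)"


section \<open>Categories presented by possibly overlapping hom-sets\<close>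

text \<open>
  In slices, categories of algebras and Grothendieck constructions the same datum may be a morphism
  between several pairs of objects. Tagging it with its source and target makes the hom-sets
  disjoint.
\<close>

datatype ('o, 'm) tagged = Tag (src: 'o) (lab: 'm) (tgt: 'o)

definition hom_category ::
  "'o set \<Rightarrow> ('o \<Rightarrow> 'o \<Rightarrow> 'm set) \<Rightarrow> ('o \<Rightarrow> 'm) \<Rightarrow> ('o \<Rightarrow> 'o \<Rightarrow> 'o \<Rightarrow> 'm \<Rightarrow> 'm \<Rightarrow> 'm)
   \<Rightarrow> ('o, ('o, 'm) tagged) cat" where
  "hom_category ob hom idn cmp =
     \<lparr>Obj = ob,
      Arr = {Tag x f y | x f y. x \<in> ob \<and> y \<in> ob \<and> f \<in> hom x y},
      Dom = src,
      Cod = tgt,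
      Ident = (\<lambda>x. Tag x (idn x) x),
      Compose = (\<lambda>g f. Tag (src f) (cmp (src f) (tgt f) (tgt g) (lab g) (lab f)) (tgt g))\<rparr>"

lemma hom_category_simps:
  "Obj (hom_category ob hom idn cmp) = ob"
  "Dom (hom_category ob hom idn cmp) = src"
  "Cod (hom_category ob hom idn cmp) = tgt"
  "Ident (hom_category ob hom idn cmp) x = Tag x (idn x) x"
  "Tag y g z \<cdot>\<^bsub>hom_category ob hom idn cmp\<^esub> Tag x f y = Tag x (cmp x y z g f) z"
  by (simp_all add: hom_category_def)

lemma Hom_hom_category:
  "Hom (hom_category ob hom idn cmp) x y = {Tag x f y | f. x \<in> ob \<and> y \<in> ob \<and> f \<in> hom x y}"
  by (auto simp: Hom_def hom_category_def)

lemma category_hom_category: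
  assumes "\<And>x. x \<in> ob \<Longrightarrow> idn x \<in> hom x x"
    and "\<And>x y z f g. \<lbrakk>x \<in> ob; y \<in> ob; z \<in> ob; f \<in> hom x y; g \<in> hom y z\<rbrakk> \<Longrightarrow> cmp x y z g f \<in> hom x z"
    and "\<And>x y f. \<lbrakk>x \<in> ob; y \<in> ob; f \<in> hom x y\<rbrakk> \<Longrightarrow> cmp x x y f (idn x) = f"
    and "\<And>x y f. \<lbrakk>x \<in> ob; y \<in> ob; f \<in> hom x y\<rbrakk> \<Longrightarrow> cmp x y y (idn y) f = f"
    and "\<And>w x y z f g h. \<lbrakk>w \<in> ob; x \<in> ob; y \<in> ob; z \<in> ob; f \<in> hom w x; g \<in> hom x y; h \<in> hom y z\<rbrakk>
      \<Longrightarrow> cmp w x z (cmp x y z h g) f = cmp w y z h (cmp w x y g f)"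
  shows "category (hom_category ob hom idn cmp)"
  by unfold_locales
     (use assms in \<open>auto simp: Hom_hom_category hom_category_simps\<close>,
      auto simp: hom_category_def)


section \<open>Adjunctions and monadicity\<close>

locale adjunction =
  F: is_functor C D F + G: is_functor D C G +
  unit: nat_trans C C fctr_id "G \<circ>\<^sub>F F" \<eta> + counit: nat_trans D D "F \<circ>\<^sub>F G" fctr_id \<epsilon>
  for C :: "('o, 'm) cat" and D :: "('p, 'n) cat" and F G \<eta> \<epsilon> +
  assumes triangle_left:
      "x \<in> Obj C \<Longrightarrow> \<epsilon> (omap F x) \<cdot>\<^bsub>D\<^esub> amap F (\<eta> x) = Ident D (omap F x)"
    and triangle_right:
      "y \<in> Obj D \<Longrightarrow> amap G (\<epsilon> y) \<cdot>\<^bsub>C\<^esub> \<eta> (omap G y) = Ident C (omap G y)"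

text \<open>Eilenberg-Moore category of a monad with endofunctor \<open>T\<close>, unit \<open>\<eta>\<close> and multiplication \<open>\<mu>\<close>.\<close>

definition EM_obj ::
  "('o, 'm) cat \<Rightarrow> ('o, 'm, 'o, 'm) fctr \<Rightarrow> ('o \<Rightarrow> 'm) \<Rightarrow> ('o \<Rightarrow> 'm) \<Rightarrow> ('o \<times> 'm) set" where
  "EM_obj C T \<eta> \<mu> = {(x, h). x \<in> Obj C \<and> h \<in> Hom C (omap T x) x \<and>
     h \<cdot>\<^bsub>C\<^esub> \<eta> x = Ident C x \<and> h \<cdot>\<^bsub>C\<^esub> amap T h = h \<cdot>\<^bsub>C\<^esub> \<mu> x}"

definition EM_hom ::
  "('o, 'm) cat \<Rightarrow> ('o, 'm, 'o, 'm) fctr \<Rightarrow> 'o \<times> 'm \<Rightarrow> 'o \<times> 'm \<Rightarrow> 'm set" where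
  "EM_hom C T = (\<lambda>(x, h) (y, k). {f \<in> Hom C x y. f \<cdot>\<^bsub>C\<^esub> h = k \<cdot>\<^bsub>C\<^esub> amap T f})"

definition EM ::
  "('o, 'm) cat \<Rightarrow> ('o, 'm, 'o, 'm) fctr \<Rightarrow> ('o \<Rightarrow> 'm) \<Rightarrow> ('o \<Rightarrow> 'm)
   \<Rightarrow> ('o \<times> 'm, ('o \<times> 'm, 'm) tagged) cat" where
  "EM C T \<eta> \<mu> = hom_category (EM_obj C T \<eta> \<mu>) (EM_hom C T)
     (\<lambda>(x, h). Ident C x) (\<lambda>_ _ _ g f. g \<cdot>\<^bsub>C\<^esub> f)"

text \<open>
  For an adjunction \<open>F \<stileturn> G\<close>, with \<open>F\<close> from \<open>C\<close> to \<open>D\<close>, the induced monad on \<open>C\<close> is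
  \<open>(GF, \<eta>, G\<epsilon>F)\<close>, and the comparison functor is \<open>y \<mapsto> (G y, G \<epsilon>\<^sub>y)\<close>.
\<close>

definition adj_EM ::
  "('o, 'm) cat \<Rightarrow> ('o, 'm, 'p, 'n) fctr \<Rightarrow> ('p, 'n, 'o, 'm) fctr \<Rightarrow> ('o \<Rightarrow> 'm) \<Rightarrow> ('p \<Rightarrow> 'n)
   \<Rightarrow> ('o \<times> 'm, ('o \<times> 'm, 'm) tagged) cat" where
  "adj_EM C F G \<eta> \<epsilon> = EM C (G \<circ>\<^sub>F F) \<eta> (\<lambda>x. amap G (\<epsilon> (omap F x)))"

definition comparison_obj :: "('p, 'n, 'o, 'm) fctr \<Rightarrow> ('p \<Rightarrow> 'n) \<Rightarrow> 'p \<Rightarrow> 'o \<times> 'm" where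
  "comparison_obj G \<epsilon> y = (omap G y, amap G (\<epsilon> y))"

definition comparison ::
  "('p, 'n) cat \<Rightarrow> ('p, 'n, 'o, 'm) fctr \<Rightarrow> ('p \<Rightarrow> 'n)
   \<Rightarrow> ('p, 'n, 'o \<times> 'm, ('o \<times> 'm, 'm) tagged) fctr" where
  "comparison D G \<epsilon> =
     \<lparr>omap = comparison_obj G \<epsilon>,
      amap = (\<lambda>k. Tag (comparison_obj G \<epsilon> (Dom D k)) (amap G k) (comparison_obj G \<epsilon> (Cod D k)))\<rparr>"

definition monadic_adjunction ::
  "('o, 'm) cat \<Rightarrow> ('p, 'n) cat \<Rightarrow> ('o, 'm, 'p, 'n) fctr \<Rightarrow> ('p, 'n, 'o, 'm) fctr
   \<Rightarrow> ('o \<Rightarrow> 'm) \<Rightarrow> ('p \<Rightarrow> 'n) \<Rightarrow> bool" where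
  "monadic_adjunction C D F G \<eta> \<epsilon> \<longleftrightarrow>
     adjunction C D F G \<eta> \<epsilon> \<and> is_equivalence D (adj_EM C F G \<eta> \<epsilon>) (comparison D G \<epsilon>)"


section \<open>Effective descent morphisms\<close>

definition slice :: "('o, 'm) cat \<Rightarrow> 'o \<Rightarrow> ('m, ('m, 'm) tagged) cat" where
  "slice X b = hom_category {f \<in> Arr X. Cod X f = b}
     (\<lambda>f g. {h \<in> Hom X (Dom X f) (Dom X g). g \<cdot>\<^bsub>X\<^esub> h = f})
     (\<lambda>f. Ident X (Dom X f)) (\<lambda>_ _ _ k h. k \<cdot>\<^bsub>X\<^esub> h)"

text \<open>The functor \<open>f \<mapsto> p \<cdot> f\<close> from the slice over the domain of \<open>p\<close> to the slice over its codomain.\<close>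

definition slice_push :: "('o, 'm) cat \<Rightarrow> 'm \<Rightarrow> ('m, ('m, 'm) tagged, 'm, ('m, 'm) tagged) fctr" where
  "slice_push X p =
     \<lparr>omap = (\<lambda>f. p \<cdot>\<^bsub>X\<^esub> f),
      amap = (\<lambda>t. Tag (p \<cdot>\<^bsub>X\<^esub> src t) (lab t) (p \<cdot>\<^bsub>X\<^esub> tgt t))\<rparr>"

definition is_pullback :: "('o, 'm) cat \<Rightarrow> 'm \<Rightarrow> 'm \<Rightarrow> 'm \<Rightarrow> 'm \<Rightarrow> bool" where
  "is_pullback X p g p' g' \<longleftrightarrow>
     p \<in> Arr X \<and> g \<in> Arr X \<and> p' \<in> Arr X \<and> g' \<in> Arr X \<and>
     Cod X p = Cod X g \<and> Dom X p' = Dom X g' \<and> Cod X p' = Dom X g \<and> Cod X g' = Dom X p \<and>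
     p \<cdot>\<^bsub>X\<^esub> g' = g \<cdot>\<^bsub>X\<^esub> p' \<and>
     (\<forall>w \<in> Obj X. \<forall>u \<in> Hom X w (Dom X p). \<forall>v \<in> Hom X w (Dom X g). p \<cdot>\<^bsub>X\<^esub> u = g \<cdot>\<^bsub>X\<^esub> v \<longrightarrow>
        (\<exists>!t. t \<in> Hom X w (Dom X p') \<and> g' \<cdot>\<^bsub>X\<^esub> t = u \<and> p' \<cdot>\<^bsub>X\<^esub> t = v))"

definition pullbacks_along_exist :: "('o, 'm) cat \<Rightarrow> 'm \<Rightarrow> bool" where
  "pullbacks_along_exist X p \<longleftrightarrow>
     (\<forall>g \<in> Arr X. Cod X g = Cod X p \<longrightarrow> (\<exists>p' g'. is_pullback X p g p' g'))"

text \<open>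
  The right adjoint \<open>P\<close> of \<open>slice_push X p\<close> is determined up to isomorphism, so it does not matter
  which one is taken.
\<close>

definition effective_descent :: "('o, 'm) cat \<Rightarrow> 'm \<Rightarrow> bool" where
  "effective_descent X p \<longleftrightarrow> p \<in> Arr X \<and> pullbacks_along_exist X p \<and>
     (\<exists>P \<eta> \<epsilon>. monadic_adjunction (slice X (Dom X p)) (slice X (Cod X p)) (slice_push X p) P \<eta> \<epsilon>)"

definition preserves_effective_descent ::
  "('o, 'm) cat \<Rightarrow> ('p, 'n) cat \<Rightarrow> ('o, 'm, 'p, 'n) fctr \<Rightarrow> bool" where
  "preserves_effective_descent X Y F \<longleftrightarrow>
     (\<forall>p. effective_descent X p \<longrightarrow> effective_descent Y (amap F p))"


section \<open>Pseudofunctors and the Grothendieck construction\<close>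

text \<open>
  The data of a pseudofunctor from the opposite of a category to categories: for \<open>f\<close> from \<open>a\<close> to
  \<open>b\<close>, \<open>reindex f\<close> is a functor from \<open>fibre b\<close> to \<open>fibre a\<close>; \<open>unitor a\<close> has components
  \<open>x \<rightarrow> reindex (1\<^sub>a) x\<close> and \<open>compositor f g\<close> has components
  \<open>reindex f (reindex g x) \<rightarrow> reindex (g \<cdot> f) x\<close>. All fibres use the same types of objects and of
  arrows; this is no restriction, since any family of small categories can be moved into disjoint
  sums of its sets of objects and of arrows.
\<close>

record ('a, 'f, 'x, 'y) psfctr =
  fibre :: "'a \<Rightarrow> ('x, 'y) cat"
  reindex :: "'f \<Rightarrow> ('x, 'y, 'x, 'y) fctr"
  unitor :: "'a \<Rightarrow> 'x \<Rightarrow> 'y"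
  compositor :: "'f \<Rightarrow> 'f \<Rightarrow> 'x \<Rightarrow> 'y"

locale pseudofunctor =
  A: category A for A :: "('a, 'f) cat" +
  fixes F :: "('a, 'f, 'x, 'y) psfctr"
  assumes fibre_category: "a \<in> Obj A \<Longrightarrow> category (fibre F a)"
    and reindex_functor:
      "f \<in> Hom A a b \<Longrightarrow> is_functor (fibre F b) (fibre F a) (reindex F f)"
    and unitor_iso: "a \<in> Obj A \<Longrightarrow>
      nat_iso (fibre F a) (fibre F a) fctr_id (reindex F (Ident A a)) (unitor F a)"
    and compositor_iso: "f \<in> Hom A a b \<Longrightarrow> g \<in> Hom A b c \<Longrightarrow>
      nat_iso (fibre F c) (fibre F a) (reindex F f \<circ>\<^sub>F reindex F g) (reindex F (g \<cdot>\<^bsub>A\<^esub> f))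
        (compositor F f g)"
    and coherence_unit_left: "f \<in> Hom A a b \<Longrightarrow> x \<in> Obj (fibre F b) \<Longrightarrow>
      compositor F (Ident A a) f x \<cdot>\<^bsub>fibre F a\<^esub> unitor F a (omap (reindex F f) x)
        = Ident (fibre F a) (omap (reindex F f) x)"
    and coherence_unit_right: "f \<in> Hom A a b \<Longrightarrow> x \<in> Obj (fibre F b) \<Longrightarrow>
      compositor F f (Ident A b) x \<cdot>\<^bsub>fibre F a\<^esub> amap (reindex F f) (unitor F b x)
        = Ident (fibre F a) (omap (reindex F f) x)"
    and coherence_assoc:
      "f \<in> Hom A a b \<Longrightarrow> g \<in> Hom A b c \<Longrightarrow> h \<in> Hom A c d \<Longrightarrow> x \<in> Obj (fibre F d) \<Longrightarrow>
      compositor F f (h \<cdot>\<^bsub>A\<^esub> g) x \<cdot>\<^bsub>fibre F a\<^esub> amap (reindex F f) (compositor F g h x)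
        = compositor F (g \<cdot>\<^bsub>A\<^esub> f) h x \<cdot>\<^bsub>fibre F a\<^esub> compositor F f g (omap (reindex F h) x)"

definition grothendieck ::
  "('a, 'f) cat \<Rightarrow> ('a, 'f, 'x, 'y) psfctr \<Rightarrow> ('a \<times> 'x, ('a \<times> 'x, 'f \<times> 'y) tagged) cat" where
  "grothendieck A F = hom_category
     (SIGMA a:Obj A. Obj (fibre F a))
     (\<lambda>(a, x) (b, y). {(f, \<phi>). f \<in> Hom A a b \<and> \<phi> \<in> Hom (fibre F a) x (omap (reindex F f) y)})
     (\<lambda>(a, x). (Ident A a, unitor F a x))
     (\<lambda>(a, x) (b, y) (c, z) (g, \<psi>) (f, \<phi>).
        (g \<cdot>\<^bsub>A\<^esub> f,
         compositor F f g z \<cdot>\<^bsub>fibre F a\<^esub> (amap (reindex F f) \<psi> \<cdot>\<^bsub>fibre F a\<^esub> \<phi>)))"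

definition grothendieck_proj ::
  "('a, 'f, 'x, 'y) psfctr \<Rightarrow> ('a \<times> 'x, ('a \<times> 'x, 'f \<times> 'y) tagged, 'a, 'f) fctr" where
  "grothendieck_proj F = \<lparr>omap = fst, amap = fst \<circ> lab\<rparr>"

end

theory Submission
  imports Defs
begin

text \<open>
  Write \<open>X\<close> for the Grothendieck construction and \<open>U\<close> for its projection to \<open>A\<close>. An arrow from
  \<open>(a, x)\<close> to \<open>(b, y)\<close> over \<open>f\<close> is an arrow of the fibre over \<open>a\<close> from \<open>x\<close> to the reindexing of \<open>y\<close>
  along \<open>f\<close>; if \<open>x\<close> is initial, there is exactly one. Sending \<open>a\<close> to \<open>(a, 0\<^sub>a)\<close> is therefore a
  fully faithful left adjoint \<open>I\<close> of \<open>U\<close> with \<open>U I = 1\<close>. Since the initial objects are strict and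
  preserved by reindexing, the source of an arrow into some \<open>(c, 0\<^sub>c)\<close> is again of the form \<open>(a, x)\<close>
  with \<open>x\<close> initial, and so isomorphic to an object of the image of \<open>I\<close>.

  Let \<open>p\<close> from \<open>a\<close> to \<open>b\<close> be an effective descent morphism of \<open>X\<close>. As a right adjoint, \<open>U\<close> turns
  pullbacks along \<open>p\<close> into pullbacks along \<open>U p\<close> (\<open>pullbacks_along_U\<close>). For monadicity, note that
  the adjunction between \<open>I\<close> and \<open>U\<close> passes to slices, so that the slice of \<open>A\<close> over \<open>U b\<close> is
  a coreflective full subcategory of the slice of \<open>X\<close> over \<open>b\<close>, and likewise for \<open>a\<close>. Composition
  with \<open>p\<close> restricts to composition with \<open>U p\<close>. By strictness pullback along \<open>p\<close> also preserves
  these subcategories: a pullback of an object over \<open>b\<close> with initial fibre part maps to that object. Hence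
  the adjunction for \<open>U p\<close> is the restriction of the one for \<open>p\<close>, and its algebras are the algebras
  for \<open>p\<close> whose carrier lies in the subcategory. The comparison functor for \<open>U p\<close> is thus fully
  faithful along with the one for \<open>p\<close>.

  It remains to see that an algebra whose carrier lies in the subcategory comes from an object
  of the subcategory. By monadicity it comes from some \<open>g\<close> over \<open>b\<close>. The coreflection
  of \<open>g\<close> has a pullback with the same image under \<open>U\<close>, because \<open>U\<close> preserves pullbacks; both
  pullbacks lie in the subcategory, so they are isomorphic, and the coreflection of \<open>g\<close>
  can be used instead of \<open>g\<close> (\<open>P_\<gamma>_inverse\<close>, \<open>restricted_monadic\<close>).

  These steps are carried out for an arbitrary functor \<open>U\<close> with a strict family of objects having the
  universal property of the \<open>(a, 0\<^sub>a)\<close>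
  (\<open>preserves_effective_descent_if_strict_relatively_initial\<close>).
\<close>

section \<open>Arrow calculus in categories and functors\<close>

lemma in_Hom: "f \<in> Hom C x y \<longleftrightarrow> f \<in> Arr C \<and> Dom C f = x \<and> Cod C f = y"
  by (auto simp: Hom_def)

definition inverse_arrows :: "('o, 'm) cat \<Rightarrow> 'm \<Rightarrow> 'm \<Rightarrow> bool" where
  "inverse_arrows C f g \<longleftrightarrow> f \<in> Arr C \<and> g \<in> Hom C (Cod C f) (Dom C f) \<and>
     g \<cdot>\<^bsub>C\<^esub> f = Ident C (Dom C f) \<and> f \<cdot>\<^bsub>C\<^esub> g = Ident C (Cod C f)"

text \<open>
  In axioms such as \<open>Compose_in\<close> the middle object occurs only in the premises, so conditional
  rewriting cannot find it. The axioms are therefore restated with \<open>Arr\<close>, \<open>Dom\<close> and \<open>Cod\<close>, so that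
  the simplifier discharges typing conditions by computing domains and codomains and
  normalises composites to the right.
\<close>

context category
begin

lemmas Dom_Obj [simp] = Dom_in
lemmas Cod_Obj [simp] = Cod_in

lemma Ident_Arr [simp]:
  assumes "x \<in> Obj C"
  shows "Ident C x \<in> Arr C" "Dom C (Ident C x) = x" "Cod C (Ident C x) = x"
  using Ident_in[OF assms] by (auto simp: in_Hom)

lemma Compose_Arr [simp]:
  assumes "f \<in> Arr C" "g \<in> Arr C" "Cod C f = Dom C g"
  shows "g \<cdot>\<^bsub>C\<^esub> f \<in> Arr C" "Dom C (g \<cdot>\<^bsub>C\<^esub> f) = Dom C f" "Cod C (g \<cdot>\<^bsub>C\<^esub> f) = Cod C g"
  using Compose_in[of f "Dom C f" "Dom C g" g "Cod C g"] assms by (auto simp: in_Hom)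

lemma Compose_Ident [simp]:
  assumes "f \<in> Arr C"
  shows "Dom C f = x \<Longrightarrow> f \<cdot>\<^bsub>C\<^esub> Ident C x = f" "Cod C f = x \<Longrightarrow> Ident C x \<cdot>\<^bsub>C\<^esub> f = f"
  using Ident_right[of f] Ident_left[of f] assms by (auto simp: in_Hom)

lemma assoc [simp]:
  assumes "f \<in> Arr C" "g \<in> Arr C" "h \<in> Arr C" "Cod C f = Dom C g" "Cod C g = Dom C h"
  shows "(h \<cdot>\<^bsub>C\<^esub> g) \<cdot>\<^bsub>C\<^esub> f = h \<cdot>\<^bsub>C\<^esub> g \<cdot>\<^bsub>C\<^esub> f"
  using Compose_assoc[of f _ _ g _ h] assms by (auto simp: in_Hom)

lemma iso_arrow_inverse: "iso_arrow C f \<longleftrightarrow> (\<exists>g. inverse_arrows C f g)"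
  by (auto simp: iso_arrow_def inverse_arrows_def)

lemma inverse_arrows_sym: "inverse_arrows C f g \<Longrightarrow> inverse_arrows C g f"
  by (auto simp: inverse_arrows_def in_Hom)

lemma cancel_inverse:
  assumes "inverse_arrows C f g" "h \<in> Arr C"
  shows "Cod C h = Dom C f \<Longrightarrow> g \<cdot>\<^bsub>C\<^esub> f \<cdot>\<^bsub>C\<^esub> h = h"
    and "Cod C h = Cod C f \<Longrightarrow> f \<cdot>\<^bsub>C\<^esub> g \<cdot>\<^bsub>C\<^esub> h = h"
proof -
  have fg: "f \<in> Arr C" "g \<in> Arr C" "Dom C g = Cod C f" "Cod C g = Dom C f"
    and inv: "g \<cdot>\<^bsub>C\<^esub> f = Ident C (Dom C f)" "f \<cdot>\<^bsub>C\<^esub> g = Ident C (Cod C f)"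
    using assms(1) by (auto simp: inverse_arrows_def in_Hom)
  show "g \<cdot>\<^bsub>C\<^esub> f \<cdot>\<^bsub>C\<^esub> h = h" if "Cod C h = Dom C f"
    by (subst assoc[symmetric]) (use assms(2) that fg inv in simp_all)
  show "f \<cdot>\<^bsub>C\<^esub> g \<cdot>\<^bsub>C\<^esub> h = h" if "Cod C h = Cod C f"
    by (subst assoc[symmetric]) (use assms(2) that fg inv in simp_all)
qed

lemma inverse_arrows_Compose:
  assumes "inverse_arrows C f g" "inverse_arrows C h k" "Cod C f = Dom C h"
  shows "inverse_arrows C (h \<cdot>\<^bsub>C\<^esub> f) (g \<cdot>\<^bsub>C\<^esub> k)"
  using assms cancel_inverse(1)[OF assms(2), of f] cancel_inverse(2)[OF assms(1), of k]
  by (auto simp: inverse_arrows_def in_Hom)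

end

context is_functor
begin

lemma omap_Obj [simp]: "x \<in> Obj C \<Longrightarrow> omap F x \<in> Obj D"
  by (rule omap_in)

lemma amap_Arr [simp]:
  assumes "f \<in> Arr C"
  shows "amap F f \<in> Arr D" "Dom D (amap F f) = omap F (Dom C f)"
    "Cod D (amap F f) = omap F (Cod C f)"
  using amap_in[of f "Dom C f" "Cod C f"] assms by (auto simp: in_Hom)

lemmas amap_Ident' [simp] = amap_Ident

lemma amap_Comp [simp]:
  assumes "f \<in> Arr C" "g \<in> Arr C" "Cod C f = Dom C g"
  shows "amap F (g \<cdot>\<^bsub>C\<^esub> f) = amap F g \<cdot>\<^bsub>D\<^esub> amap F f"
  using amap_Compose[of f "Dom C f" "Dom C g" g] assms by (auto simp: in_Hom)

lemma amap_inverse_arrows: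
  assumes "inverse_arrows C f g"
  shows "inverse_arrows D (amap F f) (amap F g)"
  using assms amap_Comp[of f g] amap_Comp[of g f]
  unfolding inverse_arrows_def by (auto simp: in_Hom)

end

lemma (in category) is_functor_fctr_id: "is_functor C C fctr_id"
  by unfold_locales (auto simp: fctr_id_def)

lemma is_functor_fctr_comp:
  assumes "is_functor C D F" "is_functor D E G"
  shows "is_functor C E (G \<circ>\<^sub>F F)"
proof -
  interpret F: is_functor C D F by fact
  interpret G: is_functor D E G by fact
  show ?thesis
    by unfold_locales (auto simp: fctr_comp_def in_Hom)
qed

lemma fctr_simps [simp]:
  "omap fctr_id x = x" "amap fctr_id f = f"
  "omap (G \<circ>\<^sub>F F) x = omap G (omap F x)" "amap (G \<circ>\<^sub>F F) f = amap G (amap F f)"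
  by (auto simp: fctr_id_def fctr_comp_def)

context nat_trans
begin

lemma component_Arr [simp]:
  assumes "x \<in> Obj C"
  shows "\<tau> x \<in> Arr D" "Dom D (\<tau> x) = omap F x" "Cod D (\<tau> x) = omap G x"
  using component_in[OF assms] by (auto simp: in_Hom)

lemma natural: "f \<in> Arr C \<Longrightarrow> amap G f \<cdot>\<^bsub>D\<^esub> \<tau> (Dom C f) = \<tau> (Cod C f) \<cdot>\<^bsub>D\<^esub> amap F f"
  by (rule naturality) (simp add: in_Hom)

end

text \<open>
  Fullness turns a choice of isomorphisms \<open>m d\<close> from objects in the image of \<open>F\<close> into a
  quasi-inverse: an arrow \<open>h\<close> is sent to the lift of its conjugate by \<open>m\<close>. Faithfulness makes this
  functorial and makes the lifts of the inverses of \<open>m\<close> a natural unit.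
\<close>

lemma is_equivalenceI:
  assumes "is_functor C D F"
    and faithful: "\<And>f g. \<lbrakk>f \<in> Arr C; g \<in> Arr C; Dom C f = Dom C g; Cod C f = Cod C g;
      amap F f = amap F g\<rbrakk> \<Longrightarrow> f = g"
    and full: "\<And>x y h. \<lbrakk>x \<in> Obj C; y \<in> Obj C; h \<in> Hom D (omap F x) (omap F y)\<rbrakk>
      \<Longrightarrow> \<exists>f \<in> Hom C x y. amap F f = h"
    and eso: "\<And>d. d \<in> Obj D \<Longrightarrow> \<exists>x \<in> Obj C. isomorphic D (omap F x) d"
  shows "is_equivalence C D F"
proof -
  interpret F: is_functor C D F by fact
  have "\<forall>d\<in>Obj D. \<exists>x m n. x \<in> Obj C \<and> m \<in> Hom D (omap F x) d \<and> inverse_arrows D m n"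
    using eso by (meson F.D.iso_arrow_inverse isomorphic_def)
  then obtain g m n where gmn: "\<And>d. d \<in> Obj D \<Longrightarrow>
      g d \<in> Obj C \<and> m d \<in> Hom D (omap F (g d)) d \<and> inverse_arrows D (m d) (n d)"
    by metis
  have g [simp]: "d \<in> Obj D \<Longrightarrow> g d \<in> Obj C" for d using gmn by auto
  have m [simp]: "d \<in> Obj D \<Longrightarrow> m d \<in> Arr D" "d \<in> Obj D \<Longrightarrow> Dom D (m d) = omap F (g d)"
    "d \<in> Obj D \<Longrightarrow> Cod D (m d) = d" for d using gmn by (auto simp: in_Hom)
  have n [simp]: "d \<in> Obj D \<Longrightarrow> n d \<in> Arr D" "d \<in> Obj D \<Longrightarrow> Dom D (n d) = d"
    "d \<in> Obj D \<Longrightarrow> Cod D (n d) = omap F (g d)"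
    "d \<in> Obj D \<Longrightarrow> n d \<cdot>\<^bsub>D\<^esub> m d = Ident D (omap F (g d))"
    "d \<in> Obj D \<Longrightarrow> m d \<cdot>\<^bsub>D\<^esub> n d = Ident D d" for d
    using gmn[of d] by (auto simp: inverse_arrows_def in_Hom)
  have mn [simp]: "\<lbrakk>d \<in> Obj D; h \<in> Arr D; Cod D h = d\<rbrakk> \<Longrightarrow> m d \<cdot>\<^bsub>D\<^esub> n d \<cdot>\<^bsub>D\<^esub> h = h"
    and nm [simp]: "\<lbrakk>d \<in> Obj D; h \<in> Arr D; Cod D h = omap F (g d)\<rbrakk> \<Longrightarrow> n d \<cdot>\<^bsub>D\<^esub> m d \<cdot>\<^bsub>D\<^esub> h = h" for d h
    using F.D.cancel_inverse[of "m d" "n d" h] gmn[of d] by auto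
  define lift where "lift x y h = (SOME f. f \<in> Hom C x y \<and> amap F f = h)" for x y h
  have lift: "lift x y h \<in> Hom C x y \<and> amap F (lift x y h) = h"
    if "x \<in> Obj C" "y \<in> Obj C" "h \<in> Hom D (omap F x) (omap F y)" for x y h
    unfolding lift_def by (rule someI_ex) (use full[OF that] in blast)
  define a where "a h = lift (g (Dom D h)) (g (Cod D h)) (n (Cod D h) \<cdot>\<^bsub>D\<^esub> h \<cdot>\<^bsub>D\<^esub> m (Dom D h))" for h
  have a [simp]: "a h \<in> Arr C" "Dom C (a h) = g (Dom D h)" "Cod C (a h) = g (Cod D h)"
    "amap F (a h) = n (Cod D h) \<cdot>\<^bsub>D\<^esub> h \<cdot>\<^bsub>D\<^esub> m (Dom D h)" if "h \<in> Arr D" for h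
    using lift[of "g (Dom D h)" "g (Cod D h)" "n (Cod D h) \<cdot>\<^bsub>D\<^esub> h \<cdot>\<^bsub>D\<^esub> m (Dom D h)"] that
    by (auto simp: a_def in_Hom)
  define G where "G = \<lparr>omap = g, amap = a\<rparr>"
  have G [simp]: "omap G = g" "amap G = a" by (auto simp: G_def)
  interpret G: is_functor D C G
    by unfold_locales (auto simp: in_Hom intro!: faithful)
  define s where "s x = lift x (g (omap F x)) (n (omap F x))" for x
  define s' where "s' x = lift (g (omap F x)) x (m (omap F x))" for x
  have s [simp]: "s x \<in> Arr C" "Dom C (s x) = x" "Cod C (s x) = g (omap F x)"
    "amap F (s x) = n (omap F x)" if "x \<in> Obj C" for x
    using lift[of x "g (omap F x)" "n (omap F x)"] that by (auto simp: s_def in_Hom)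
  have s' [simp]: "s' x \<in> Arr C" "Cod C (s' x) = x" "Dom C (s' x) = g (omap F x)"
    "amap F (s' x) = m (omap F x)" if "x \<in> Obj C" for x
    using lift[of "g (omap F x)" x "m (omap F x)"] that by (auto simp: s'_def in_Hom)
  have "s' x \<cdot>\<^bsub>C\<^esub> s x = Ident C x \<and> s x \<cdot>\<^bsub>C\<^esub> s' x = Ident C (g (omap F x))" if "x \<in> Obj C" for x
    by (intro conjI faithful) (use that in auto)
  then have s_iso: "iso_arrow C (s x)" if "x \<in> Obj C" for x
    using that unfolding iso_arrow_def by (auto simp: in_Hom intro!: bexI[of _ "s' x"])
  have FG: "is_functor D D (F \<circ>\<^sub>F G)" and GF: "is_functor C C (G \<circ>\<^sub>F F)"
    by (auto intro: is_functor_fctr_comp F.is_functor_axioms G.is_functor_axioms)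
  have "nat_iso C C fctr_id (G \<circ>\<^sub>F F) s"
    by (intro nat_iso.intro nat_trans.intro GF F.C.is_functor_fctr_id;
        unfold_locales; auto simp: in_Hom s_iso intro!: faithful)
  moreover have "nat_iso D D (F \<circ>\<^sub>F G) fctr_id m"
  proof (intro nat_iso.intro nat_trans.intro FG F.D.is_functor_fctr_id; unfold_locales)
    show "iso_arrow D (m x)" if "x \<in> Obj D" for x
      using gmn that F.D.iso_arrow_inverse by blast
  qed (auto simp: in_Hom)
  ultimately show ?thesis
    unfolding is_equivalence_def using F.is_functor_axioms G.is_functor_axioms by blast
qed

text \<open>
  The unit \<open>s\<close> expresses every arrow \<open>f\<close> as a conjugate of its image under \<open>G \<circ>\<^sub>F F\<close>, so \<open>F\<close> is
  faithful; the counit does the same for \<open>G\<close>. Fullness of \<open>F\<close> then follows by applying the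
  faithful \<open>G\<close> to the candidate preimage.
\<close>

lemma is_equivalenceD:
  assumes "is_equivalence C D F"
  shows "is_functor C D F"
    and "\<lbrakk>f \<in> Arr C; g \<in> Arr C; Dom C f = Dom C g; Cod C f = Cod C g;
      amap F f = amap F g\<rbrakk> \<Longrightarrow> f = g"
    and "\<lbrakk>x \<in> Obj C; y \<in> Obj C; h \<in> Hom D (omap F x) (omap F y)\<rbrakk>
      \<Longrightarrow> \<exists>f \<in> Hom C x y. amap F f = h"
    and "d \<in> Obj D \<Longrightarrow> \<exists>x \<in> Obj C. isomorphic D (omap F x) d"
proof -
  obtain G s t where "is_functor C D F" "is_functor D C G"
    "nat_iso C C fctr_id (G \<circ>\<^sub>F F) s" "nat_iso D D (F \<circ>\<^sub>F G) fctr_id t"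
    using assms unfolding is_equivalence_def by blast
  interpret F: is_functor C D F by fact
  interpret G: is_functor D C G by fact
  interpret s: nat_iso C C fctr_id "G \<circ>\<^sub>F F" s by fact
  interpret t: nat_iso D D "F \<circ>\<^sub>F G" fctr_id t by fact
  show "is_functor C D F" by fact
  obtain s' where s': "\<And>x. x \<in> Obj C \<Longrightarrow> inverse_arrows C (s x) (s' x)"
    using s.component_iso unfolding F.C.iso_arrow_inverse by metis
  obtain t' where t': "\<And>x. x \<in> Obj D \<Longrightarrow> inverse_arrows D (t x) (t' x)"
    using t.component_iso unfolding F.D.iso_arrow_inverse by metis
  \<comment> \<open>Every arrow is recovered from its image under \<open>G \<circ>\<^sub>F F\<close>.\<close>
  have conj_s: "f = s' (Cod C f) \<cdot>\<^bsub>C\<^esub> amap G (amap F f) \<cdot>\<^bsub>C\<^esub> s (Dom C f)" if "f \<in> Arr C" for f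
    using s.natural[OF that] F.C.cancel_inverse(1)[OF s'[of "Cod C f"], of f] that by simp
  show F_faithful: "f = g" if "f \<in> Arr C" "g \<in> Arr C" "Dom C f = Dom C g" "Cod C f = Cod C g"
      "amap F f = amap F g" for f g
    using conj_s[OF that(1)] conj_s[OF that(2)] that by simp
  have G_faithful: "f = g" if "f \<in> Arr D" "g \<in> Arr D" "Dom D f = Dom D g" "Cod D f = Cod D g"
      "amap G f = amap G g" for f g
  proof -
    have *: "f \<cdot>\<^bsub>D\<^esub> t (Dom D f) \<cdot>\<^bsub>D\<^esub> t' (Dom D f) = f" if "f \<in> Arr D" for f
      using t'[of "Dom D f"] that by (auto simp: inverse_arrows_def)
    have "f \<cdot>\<^bsub>D\<^esub> t (Dom D f) = g \<cdot>\<^bsub>D\<^esub> t (Dom D g)"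
      using t.natural[of f] t.natural[of g] that by simp
    then have "(f \<cdot>\<^bsub>D\<^esub> t (Dom D f)) \<cdot>\<^bsub>D\<^esub> t' (Dom D f) = (g \<cdot>\<^bsub>D\<^esub> t (Dom D g)) \<cdot>\<^bsub>D\<^esub> t' (Dom D g)"
      using that by simp
    then show ?thesis
      using *[of f] *[of g] t'[of "Dom D g"] that
      by (auto simp: inverse_arrows_def in_Hom)
  qed
  show "\<exists>f \<in> Hom C x y. amap F f = h"
    if h: "x \<in> Obj C" "y \<in> Obj C" "h \<in> Hom D (omap F x) (omap F y)" for x y h
  proof -
    define f where "f = s' y \<cdot>\<^bsub>C\<^esub> amap G h \<cdot>\<^bsub>C\<^esub> s x"
    have s'y: "s' y \<in> Arr C" "Dom C (s' y) = omap G (omap F y)" "Cod C (s' y) = y"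
      "s y \<cdot>\<^bsub>C\<^esub> s' y = Ident C (omap G (omap F y))"
      using s'[of y] h by (auto simp: inverse_arrows_def in_Hom)
    have f: "f \<in> Arr C" "Dom C f = x" "Cod C f = y"
      using h s'y by (auto simp: f_def in_Hom)
    have sx: "s x \<cdot>\<^bsub>C\<^esub> s' x = Ident C (omap G (omap F x))" "s' x \<in> Arr C"
      "Dom C (s' x) = omap G (omap F x)" "Cod C (s' x) = x"
      using s'[of x] h by (auto simp: inverse_arrows_def in_Hom)
    have "amap G (amap F f) \<cdot>\<^bsub>C\<^esub> s x = amap G h \<cdot>\<^bsub>C\<^esub> s x"
      using s.natural[of f] f h s'y F.C.cancel_inverse(2)[OF s'[OF h(2)], of "amap G h \<cdot>\<^bsub>C\<^esub> s x"]
      by (simp add: f_def in_Hom)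
    then have "(amap G (amap F f) \<cdot>\<^bsub>C\<^esub> s x) \<cdot>\<^bsub>C\<^esub> s' x = (amap G h \<cdot>\<^bsub>C\<^esub> s x) \<cdot>\<^bsub>C\<^esub> s' x"
      by simp
    then have "amap G (amap F f) = amap G h"
      using f h sx by (simp add: in_Hom)
    then have "amap F f = h"
      using G_faithful[of "amap F f" h] f h by (simp add: in_Hom)
    then show ?thesis using f by (auto simp: in_Hom)
  qed
  show "\<exists>x \<in> Obj C. isomorphic D (omap F x) d" if "d \<in> Obj D" for d
    using t.component_in[OF that] t.component_iso[OF that] that
    by (auto simp: isomorphic_def intro!: bexI[of _ "omap G d"])
qed

section \<open>Monadicity of an adjunction in terms of its algebras\<close>

context adjunction
begin

lemma triangle_l [simp]: "x \<in> Obj C \<Longrightarrow> \<epsilon> (omap F x) \<cdot>\<^bsub>D\<^esub> amap F (\<eta> x) = Ident D (omap F x)"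
  by (rule triangle_left)

lemma triangle_r [simp]: "y \<in> Obj D \<Longrightarrow> amap G (\<epsilon> y) \<cdot>\<^bsub>C\<^esub> \<eta> (omap G y) = Ident C (omap G y)"
  by (rule triangle_right)

lemma unit_natural:
  "f \<in> Arr C \<Longrightarrow> amap G (amap F f) \<cdot>\<^bsub>C\<^esub> \<eta> (Dom C f) = \<eta> (Cod C f) \<cdot>\<^bsub>C\<^esub> f"
  using unit.natural[of f] by simp

lemma counit_natural:
  "f \<in> Arr D \<Longrightarrow> f \<cdot>\<^bsub>D\<^esub> \<epsilon> (Dom D f) = \<epsilon> (Cod D f) \<cdot>\<^bsub>D\<^esub> amap F (amap G f)"
  using counit.natural[of f] by simp

text \<open>
  Objects and arrows of the Eilenberg-Moore category without the tags that make its hom-sets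
  disjoint.
\<close>

definition algebra :: "'o \<Rightarrow> 'm \<Rightarrow> bool" where
  "algebra c h \<longleftrightarrow> c \<in> Obj C \<and> h \<in> Hom C (omap G (omap F c)) c \<and> h \<cdot>\<^bsub>C\<^esub> \<eta> c = Ident C c \<and>
     h \<cdot>\<^bsub>C\<^esub> amap G (amap F h) = h \<cdot>\<^bsub>C\<^esub> amap G (\<epsilon> (omap F c))"

definition algebra_hom :: "'o \<Rightarrow> 'm \<Rightarrow> 'o \<Rightarrow> 'm \<Rightarrow> 'm \<Rightarrow> bool" where
  "algebra_hom c h d k f \<longleftrightarrow> f \<in> Hom C c d \<and> f \<cdot>\<^bsub>C\<^esub> h = k \<cdot>\<^bsub>C\<^esub> amap G (amap F f)"

lemma algebra_hom_Compose:
  assumes "algebra a h" "algebra b k" "algebra c l" "algebra_hom a h b k f" "algebra_hom b k c l g"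
  shows "algebra_hom a h c l (g \<cdot>\<^bsub>C\<^esub> f)"
proof -
  have [simp]: "h \<in> Arr C" "Dom C h = omap G (omap F a)" "Cod C h = a"
    "k \<in> Arr C" "Dom C k = omap G (omap F b)" "Cod C k = b"
    "l \<in> Arr C" "Dom C l = omap G (omap F c)" "Cod C l = c"
    "f \<in> Arr C" "Dom C f = a" "Cod C f = b" "g \<in> Arr C" "Dom C g = b" "Cod C g = c"
    using assms by (auto simp: algebra_def algebra_hom_def in_Hom)
  have *: "f \<cdot>\<^bsub>C\<^esub> h = k \<cdot>\<^bsub>C\<^esub> amap G (amap F f)" "g \<cdot>\<^bsub>C\<^esub> k = l \<cdot>\<^bsub>C\<^esub> amap G (amap F g)"
    using assms by (auto simp: algebra_hom_def)
  have "(g \<cdot>\<^bsub>C\<^esub> f) \<cdot>\<^bsub>C\<^esub> h = (g \<cdot>\<^bsub>C\<^esub> k) \<cdot>\<^bsub>C\<^esub> amap G (amap F f)"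
    using *(1) by simp
  also have "\<dots> = l \<cdot>\<^bsub>C\<^esub> amap G (amap F (g \<cdot>\<^bsub>C\<^esub> f))"
    unfolding *(2) by simp
  finally show ?thesis by (simp add: algebra_hom_def in_Hom)
qed

text \<open>
  The forgetful functor of the Eilenberg-Moore category reflects isomorphisms.
\<close>

lemma algebra_hom_inverse:
  assumes "algebra a h" "algebra b k" "algebra_hom a h b k f" "inverse_arrows C f g"
  shows "algebra_hom b k a h g"
proof -
  have [simp]: "h \<in> Arr C" "Dom C h = omap G (omap F a)" "Cod C h = a"
    "k \<in> Arr C" "Dom C k = omap G (omap F b)" "Cod C k = b"
    "f \<in> Arr C" "Dom C f = a" "Cod C f = b" "g \<in> Arr C" "Dom C g = b" "Cod C g = a"
    using assms by (auto simp: algebra_def algebra_hom_def in_Hom inverse_arrows_def)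
  have inv: "inverse_arrows D (amap F f) (amap F g)"
    "inverse_arrows C (amap G (amap F f)) (amap G (amap F g))"
    using assms(4) F.amap_inverse_arrows G.amap_inverse_arrows by blast+
  have hom: "f \<cdot>\<^bsub>C\<^esub> h = k \<cdot>\<^bsub>C\<^esub> amap G (amap F f)"
    using assms by (auto simp: algebra_hom_def)
  have "g \<cdot>\<^bsub>C\<^esub> k = g \<cdot>\<^bsub>C\<^esub> (k \<cdot>\<^bsub>C\<^esub> amap G (amap F f)) \<cdot>\<^bsub>C\<^esub> amap G (amap F g)"
    using inv(2) by (simp add: inverse_arrows_def)
  also have "\<dots> = h \<cdot>\<^bsub>C\<^esub> amap G (amap F g)"
    unfolding hom[symmetric] using F.C.cancel_inverse(1)[OF assms(4)] by simp
  finally show ?thesis by (simp add: algebra_hom_def in_Hom)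
qed

lemma algebra_free_on: "y \<in> Obj D \<Longrightarrow> algebra (omap G y) (amap G (\<epsilon> y))"
  using counit_natural[of "\<epsilon> y"]
  by (simp add: algebra_def in_Hom flip: G.amap_Comp)

lemma algebra_hom_amap:
  "f \<in> Arr D \<Longrightarrow>
     algebra_hom (omap G (Dom D f)) (amap G (\<epsilon> (Dom D f))) (omap G (Cod D f)) (amap G (\<epsilon> (Cod D f))) (amap G f)"
  using counit_natural[of f] by (simp add: algebra_hom_def in_Hom flip: G.amap_Comp)

lemma Obj_adj_EM: "Obj (adj_EM C F G \<eta> \<epsilon>) = {(c, h). algebra c h}"
  by (auto simp: adj_EM_def EM_def EM_obj_def hom_category_simps algebra_def)

lemma Hom_adj_EM:
  "Hom (adj_EM C F G \<eta> \<epsilon>) (c, h) (d, k)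
     = {Tag (c, h) f (d, k) | f. algebra c h \<and> algebra d k \<and> algebra_hom c h d k f}"
  by (auto simp: adj_EM_def EM_def EM_obj_def EM_hom_def Hom_hom_category algebra_def algebra_hom_def)

lemma adj_EM_simps:
  "Dom (adj_EM C F G \<eta> \<epsilon>) = src" "Cod (adj_EM C F G \<eta> \<epsilon>) = tgt"
  "Ident (adj_EM C F G \<eta> \<epsilon>) (c, h) = Tag (c, h) (Ident C c) (c, h)"
  "Tag v g w \<cdot>\<^bsub>adj_EM C F G \<eta> \<epsilon>\<^esub> Tag u f v = Tag u (g \<cdot>\<^bsub>C\<^esub> f) w"
  by (simp_all add: adj_EM_def EM_def hom_category_simps)

lemma category_adj_EM: "category (adj_EM C F G \<eta> \<epsilon>)"
  unfolding adj_EM_def EM_def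
proof (rule category_hom_category; clarify)
  let ?E = "EM_obj C (G \<circ>\<^sub>F F) \<eta> (\<lambda>x. amap G (\<epsilon> (omap F x)))" and ?H = "EM_hom C (G \<circ>\<^sub>F F)"
  have E: "(c, h) \<in> ?E \<longleftrightarrow> algebra c h" and H: "f \<in> ?H (c, h) (d, k) \<longleftrightarrow> algebra_hom c h d k f" for c h d k f
    by (auto simp: EM_obj_def algebra_def EM_hom_def algebra_hom_def)
  show "Ident C c \<in> ?H (c, h) (c, h)" if "(c, h) \<in> ?E" for c h
    using that unfolding E H by (auto simp: algebra_def algebra_hom_def in_Hom)
  show "g \<cdot>\<^bsub>C\<^esub> f \<in> ?H (a, h) (c, l)"
    if "(a, h) \<in> ?E" "(b, k) \<in> ?E" "(c, l) \<in> ?E" "f \<in> ?H (a, h) (b, k)" "g \<in> ?H (b, k) (c, l)"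
    for a h b k c l f g
    using that unfolding E H by (rule algebra_hom_Compose)
qed (auto simp: EM_hom_def in_Hom)

lemma comparison_functor: "is_functor D (adj_EM C F G \<eta> \<epsilon>) (comparison D G \<epsilon>)"
proof -
  interpret EM: category "adj_EM C F G \<eta> \<epsilon>" by (rule category_adj_EM)
  show ?thesis
    by unfold_locales
       (auto simp: comparison_def comparison_obj_def adj_EM_simps Obj_adj_EM Hom_adj_EM algebra_free_on
         in_Hom[where C = D] algebra_hom_amap)
qed

lemma iso_arrow_adj_EM:
  assumes "algebra a h" "algebra b k" "algebra_hom a h b k f"
  shows "iso_arrow (adj_EM C F G \<eta> \<epsilon>) (Tag (a, h) f (b, k)) \<longleftrightarrow> iso_arrow C f"
proof
  have "Tag (a, h) f (b, k) \<in> Hom (adj_EM C F G \<eta> \<epsilon>) (a, h) (b, k)"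
    using assms by (auto simp: Hom_adj_EM)
  note f = this[unfolded in_Hom]
  have f': "f \<in> Arr C" "Dom C f = a" "Cod C f = b"
    using assms by (auto simp: algebra_hom_def in_Hom)
  show "iso_arrow C f" if "iso_arrow (adj_EM C F G \<eta> \<epsilon>) (Tag (a, h) f (b, k))"
    using that f' by (auto simp: iso_arrow_def adj_EM_simps Hom_adj_EM algebra_hom_def)
  show "iso_arrow (adj_EM C F G \<eta> \<epsilon>) (Tag (a, h) f (b, k))" if "iso_arrow C f"
  proof -
    from that obtain g where g: "inverse_arrows C f g" by (auto simp: F.C.iso_arrow_inverse)
    then have "algebra_hom b k a h g" using assms algebra_hom_inverse by blast
    then show ?thesis
      using f f' assms g
      by (auto simp: iso_arrow_def adj_EM_simps Hom_adj_EM inverse_arrows_def intro!: bexI[of _ "Tag (b, k) g (a, h)"])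
  qed
qed

text \<open>
  The three clauses say that the comparison functor is faithful, full and essentially
  surjective. In this form the property can be moved between adjunctions without
  handling quasi-inverses or tags.
\<close>

definition monadic :: bool where
  "monadic \<longleftrightarrow>
     (\<forall>f \<in> Arr D. \<forall>g \<in> Arr D. Dom D f = Dom D g \<longrightarrow> Cod D f = Cod D g \<longrightarrow> amap G f = amap G g \<longrightarrow> f = g) \<and>
     (\<forall>x \<in> Obj D. \<forall>y \<in> Obj D. \<forall>h. algebra_hom (omap G x) (amap G (\<epsilon> x)) (omap G y) (amap G (\<epsilon> y)) h \<longrightarrow>
        (\<exists>f \<in> Hom D x y. amap G f = h)) \<and>
     (\<forall>c h. algebra c h \<longrightarrow> (\<exists>y \<in> Obj D. \<exists>m. algebra_hom (omap G y) (amap G (\<epsilon> y)) c h m \<and> iso_arrow C m))"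

lemma monadic_iff: "monadic_adjunction C D F G \<eta> \<epsilon> \<longleftrightarrow> monadic"
proof -
  let ?EM = "adj_EM C F G \<eta> \<epsilon>" and ?K = "comparison D G \<epsilon>"
  have K [simp]: "omap ?K y = (omap G y, amap G (\<epsilon> y))"
    "amap ?K k = Tag (omap ?K (Dom D k)) (amap G k) (omap ?K (Cod D k))" for y k
    by (auto simp: comparison_def comparison_obj_def)
  have eso: "isomorphic ?EM (omap ?K y) (c, h) \<longleftrightarrow>
      (\<exists>m. algebra_hom (omap G y) (amap G (\<epsilon> y)) c h m \<and> iso_arrow C m)"
    if "y \<in> Obj D" "algebra c h" for y c h
    using algebra_free_on[OF that(1)] that(2)
    by (auto simp: isomorphic_def Hom_adj_EM iso_arrow_adj_EM)
  have "is_equivalence D ?EM ?K \<longleftrightarrow> monadic"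
  proof
    assume e: "is_equivalence D ?EM ?K"
    show monadic
      unfolding monadic_def
    proof (intro conjI ballI impI allI)
      show "f = g" if "f \<in> Arr D" "g \<in> Arr D" "Dom D f = Dom D g" "Cod D f = Cod D g" "amap G f = amap G g" for f g
        using is_equivalenceD(2)[OF e that(1-4)] that by simp
      show "\<exists>f \<in> Hom D x y. amap G f = h"
        if "x \<in> Obj D" "y \<in> Obj D" "algebra_hom (omap G x) (amap G (\<epsilon> x)) (omap G y) (amap G (\<epsilon> y)) h" for x y h
        using is_equivalenceD(3)[OF e that(1,2), of "Tag (omap ?K x) h (omap ?K y)"] that algebra_free_on
        by (auto simp: Hom_adj_EM)
      show "\<exists>y \<in> Obj D. \<exists>m. algebra_hom (omap G y) (amap G (\<epsilon> y)) c h m \<and> iso_arrow C m" if "algebra c h" for c h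
        using is_equivalenceD(4)[OF e, of "(c, h)"] that eso by (auto simp: Obj_adj_EM)
    qed
  next
    assume monadic
    note m = this[unfolded monadic_def]
    show "is_equivalence D ?EM ?K"
    proof (rule is_equivalenceI[OF comparison_functor])
      show "f = g" if "f \<in> Arr D" "g \<in> Arr D" "Dom D f = Dom D g" "Cod D f = Cod D g" "amap ?K f = amap ?K g" for f g
        using that m by auto
      show "\<exists>f \<in> Hom D x y. amap ?K f = t" if "x \<in> Obj D" "y \<in> Obj D" "t \<in> Hom ?EM (omap ?K x) (omap ?K y)" for x y t
      proof -
        from that(3) obtain h where h: "t = Tag (omap ?K x) h (omap ?K y)"
          "algebra_hom (omap G x) (amap G (\<epsilon> x)) (omap G y) (amap G (\<epsilon> y)) h"
          by (auto simp: Hom_adj_EM)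
        with m that(1,2) obtain f where "f \<in> Hom D x y" "amap G f = h" by blast
        then show ?thesis using h by (auto simp: in_Hom)
      qed
      show "\<exists>y \<in> Obj D. isomorphic ?EM (omap ?K y) d" if "d \<in> Obj ?EM" for d
      proof -
        from that obtain c h where "d = (c, h)" "algebra c h" by (auto simp: Obj_adj_EM)
        then show ?thesis using m eso by blast
      qed
    qed
  qed
  then show ?thesis
    using adjunction_axioms by (simp add: monadic_adjunction_def)
qed

end

section \<open>Restricting a monadic adjunction to coreflective subcategories\<close>

text \<open>
  A functor \<open>U\<close> with a left adjoint \<open>I\<close> for which the unit is an identity: \<open>I\<close> embeds \<open>A\<close> as a full
  coreflective subcategory of \<open>X\<close>, and \<open>\<delta>\<close> is the counit. The equations \<open>U_\<delta>\<close> and \<open>\<delta>_I\<close> are the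
  triangle identities. All identities are strict, which holds for the Grothendieck
  construction and is inherited by slices, so that no coherence isomorphisms appear below.
  An object lies in the subcategory up to isomorphism exactly if its \<open>\<delta>\<close> is invertible.
\<close>

locale split_coreflection =
  U: is_functor X A U + I: is_functor A X I
  for X :: "('x, 'y) cat" and A :: "('a, 'f) cat" and U I +
  fixes \<delta> :: "'x \<Rightarrow> 'y"
  assumes U_I_Obj [simp]: "a \<in> Obj A \<Longrightarrow> omap U (omap I a) = a"
    and U_I_Arr [simp]: "f \<in> Arr A \<Longrightarrow> amap U (amap I f) = f"
    and \<delta>_Hom: "x \<in> Obj X \<Longrightarrow> \<delta> x \<in> Hom X (omap I (omap U x)) x"
    and \<delta>_natural: "g \<in> Arr X \<Longrightarrow> g \<cdot>\<^bsub>X\<^esub> \<delta> (Dom X g) = \<delta> (Cod X g) \<cdot>\<^bsub>X\<^esub> amap I (amap U g)"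
    and U_\<delta> [simp]: "x \<in> Obj X \<Longrightarrow> amap U (\<delta> x) = Ident A (omap U x)"
    and \<delta>_I [simp]: "a \<in> Obj A \<Longrightarrow> \<delta> (omap I a) = Ident X (omap I a)"
begin

lemma \<delta>_Arr [simp]:
  assumes "x \<in> Obj X"
  shows "\<delta> x \<in> Arr X" "Dom X (\<delta> x) = omap I (omap U x)" "Cod X (\<delta> x) = x"
  using \<delta>_Hom[OF assms] by (auto simp: in_Hom)

text \<open>
  Up to isomorphism the source is in the image of \<open>I\<close>, and arrows out of \<open>I a\<close> correspond to arrows
  out of \<open>a\<close>.
\<close>

lemma eq_by_U:
  assumes "iso_arrow X (\<delta> (Dom X f))" "f \<in> Arr X" "g \<in> Arr X" "Dom X f = Dom X g"
    "Cod X f = Cod X g" "amap U f = amap U g"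
  shows "f = g"
proof -
  have eq: "f \<cdot>\<^bsub>X\<^esub> \<delta> (Dom X f) = g \<cdot>\<^bsub>X\<^esub> \<delta> (Dom X f)"
    using assms \<delta>_natural[of f] \<delta>_natural[of g] by simp
  obtain e where e: "inverse_arrows X (\<delta> (Dom X f)) e"
    using assms(1) U.C.iso_arrow_inverse by blast
  then have e': "e \<in> Arr X" "Cod X e = Dom X (\<delta> (Dom X f))" "Dom X e = Dom X f"
    "\<delta> (Dom X f) \<cdot>\<^bsub>X\<^esub> e = Ident X (Dom X f)"
    using assms(2) by (auto simp: inverse_arrows_def in_Hom)
  have "(f \<cdot>\<^bsub>X\<^esub> \<delta> (Dom X f)) \<cdot>\<^bsub>X\<^esub> e = (g \<cdot>\<^bsub>X\<^esub> \<delta> (Dom X f)) \<cdot>\<^bsub>X\<^esub> e"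
    unfolding eq ..
  then show ?thesis using e' assms by simp
qed

lemma U_inverse_\<delta>: "x \<in> Obj X \<Longrightarrow> inverse_arrows X (\<delta> x) e \<Longrightarrow> amap U e = Ident A (omap U x)"
  using U.amap_Comp[of e "\<delta> x"] by (simp add: inverse_arrows_def in_Hom)

text \<open>
  By naturality \<open>\<delta> (Dom X m)\<close> is a composite of the three invertible arrows \<open>I (U m)\<close>,
  \<open>\<delta> (Cod X m)\<close> and the inverse of \<open>m\<close>.
\<close>

lemma iso_\<delta>_transfer:
  assumes "inverse_arrows X m n" "iso_arrow X (\<delta> (Cod X m))"
  shows "iso_arrow X (\<delta> (Dom X m))"
proof -
  obtain e where e: "inverse_arrows X (\<delta> (Cod X m)) e"
    using assms(2) U.C.iso_arrow_inverse by blast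
  have m: "m \<in> Arr X" using assms(1) by (simp add: inverse_arrows_def)
  have "inverse_arrows X (amap I (amap U m)) (amap I (amap U n))"
    using assms(1) U.amap_inverse_arrows I.amap_inverse_arrows by blast
  then have "inverse_arrows X (n \<cdot>\<^bsub>X\<^esub> \<delta> (Cod X m) \<cdot>\<^bsub>X\<^esub> amap I (amap U m)) (amap I (amap U n) \<cdot>\<^bsub>X\<^esub> e \<cdot>\<^bsub>X\<^esub> m)"
    using assms(1) e m U.C.inverse_arrows_Compose[OF U.C.inverse_arrows_Compose[OF _ e] U.C.inverse_arrows_sym[OF assms(1)]]
    by (simp add: inverse_arrows_def in_Hom)
  moreover have "n \<cdot>\<^bsub>X\<^esub> \<delta> (Cod X m) \<cdot>\<^bsub>X\<^esub> amap I (amap U m) = \<delta> (Dom X m)"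
    using \<delta>_natural[OF m] U.C.cancel_inverse(1)[OF assms(1), of "\<delta> (Dom X m)"] m by simp
  ultimately show ?thesis using U.C.iso_arrow_inverse by metis
qed

end

text \<open>
  A functor \<open>F'\<close> that restricts to a functor \<open>F\<close> between the subcategories and commutes with the
  coreflections. In the application \<open>F'\<close> and \<open>F\<close> are the functors between slices given by
  composition with \<open>p\<close> and with \<open>U p\<close>.
\<close>

locale coreflective_square =
  S: split_coreflection C' C U I \<delta> + T: split_coreflection D' D V J \<gamma> +
  F: is_functor C D F + F': is_functor C' D' F'
  for C' C U I \<delta> D' D V J \<gamma> F F' +
  assumes F_I_Obj [simp]: "c \<in> Obj C \<Longrightarrow> omap F' (omap I c) = omap J (omap F c)"
    and F_I_Arr [simp]: "f \<in> Arr C \<Longrightarrow> amap F' (amap I f) = amap J (amap F f)"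
    and V_F_Obj [simp]: "x \<in> Obj C' \<Longrightarrow> omap V (omap F' x) = omap F (omap U x)"
    and V_F_Arr [simp]: "g \<in> Arr C' \<Longrightarrow> amap V (amap F' g) = amap F (amap U g)"
    and \<gamma>_F [simp]: "x \<in> Obj C' \<Longrightarrow> \<gamma> (omap F' x) = amap F' (\<delta> x)"

text \<open>
  The last assumption says that the right adjoint \<open>P\<close> of \<open>F'\<close> maps one subcategory into the other,
  up to isomorphism. The adjunction then restricts to the subcategories, with right adjoint
  \<open>U \<circ>\<^sub>F P \<circ>\<^sub>F J\<close>.
\<close>

locale coreflective_square_adjunction =
  coreflective_square C' C U I \<delta> D' D V J \<gamma> F F' + adj: adjunction C' D' F' P \<eta> \<epsilon>
  for C' C U I \<delta> D' D V J \<gamma> F F' P \<eta> \<epsilon> +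
  assumes iso_\<delta>_P_J: "d \<in> Obj D \<Longrightarrow> iso_arrow C' (\<delta> (omap P (omap J d)))"
begin

text \<open>
  Naturality of \<open>\<gamma>\<close> at the counit, with \<open>\<gamma> F'\<close> replaced by \<open>F' \<delta>\<close>. This is how the counit of the
  restricted adjunction, which is defined through \<open>V\<close>, is related to \<open>\<epsilon>\<close>.
\<close>

lemma \<gamma>_counit:
  assumes "g \<in> Obj D'"
  shows "\<gamma> g \<cdot>\<^bsub>D'\<^esub> amap J (amap V (\<epsilon> g)) = \<epsilon> g \<cdot>\<^bsub>D'\<^esub> amap F' (\<delta> (omap P g))"
  using T.\<delta>_natural[of "\<epsilon> g"] assms by simp

lemma J_V_counit [simp]:
  assumes "d \<in> Obj D"
  shows "amap J (amap V (\<epsilon> (omap J d))) = \<epsilon> (omap J d) \<cdot>\<^bsub>D'\<^esub> amap F' (\<delta> (omap P (omap J d)))"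
  using \<gamma>_counit[of "omap J d"] assms by simp

text \<open>
  Moving \<open>\<delta>\<close> past the unit by naturality leaves a triangle identity.
\<close>

lemma counit_unit_\<delta> [simp]:
  assumes "g \<in> Obj D'"
  shows "amap P (\<epsilon> g) \<cdot>\<^bsub>C'\<^esub> amap P (amap F' (\<delta> (omap P g))) \<cdot>\<^bsub>C'\<^esub> \<eta> (omap I (omap U (omap P g)))
    = \<delta> (omap P g)"
proof -
  have "amap P (amap F' (\<delta> (omap P g))) \<cdot>\<^bsub>C'\<^esub> \<eta> (omap I (omap U (omap P g)))
      = \<eta> (omap P g) \<cdot>\<^bsub>C'\<^esub> \<delta> (omap P g)"
    using adj.unit_natural[of "\<delta> (omap P g)"] assms by simp
  moreover have "amap P (\<epsilon> g) \<cdot>\<^bsub>C'\<^esub> \<eta> (omap P g) \<cdot>\<^bsub>C'\<^esub> \<delta> (omap P g) = \<delta> (omap P g)"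
    using adj.triangle_r[of g] assms S.U.C.assoc[of "\<delta> (omap P g)" "\<eta> (omap P g)" "amap P (\<epsilon> g)"]
    by (simp del: S.U.C.assoc)
  ultimately show ?thesis by simp
qed

text \<open>
  The first triangle identity is the image under \<open>V\<close> of the one at \<open>I c\<close>. The second is the image
  of \<open>counit_unit_\<delta>\<close> under \<open>U\<close>, which sends \<open>\<delta>\<close> to an identity.
\<close>

lemma restricted_adjunction:
  "adjunction C D F (U \<circ>\<^sub>F P \<circ>\<^sub>F J) (\<lambda>c. amap U (\<eta> (omap I c))) (\<lambda>d. amap V (\<epsilon> (omap J d)))"
proof -
  have G: "is_functor D C (U \<circ>\<^sub>F P \<circ>\<^sub>F J)"
    by (rule is_functor_fctr_comp[OF is_functor_fctr_comp[OF T.I.is_functor_axioms adj.G.is_functor_axioms] S.U.is_functor_axioms])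
  have unit: "amap U (amap P (amap J (amap F f))) \<cdot>\<^bsub>C\<^esub> amap U (\<eta> (omap I (Dom C f)))
      = amap U (\<eta> (omap I (Cod C f))) \<cdot>\<^bsub>C\<^esub> f" if "f \<in> Arr C" for f
    using arg_cong[OF adj.unit_natural[of "amap I f"], of "amap U"] that by simp
  have counit: "f \<cdot>\<^bsub>D\<^esub> amap V (\<epsilon> (omap J (Dom D f)))
      = amap V (\<epsilon> (omap J (Cod D f))) \<cdot>\<^bsub>D\<^esub> amap F (amap U (amap P (amap J f)))" if "f \<in> Arr D" for f
    using arg_cong[OF adj.counit_natural[of "amap J f"], of "amap V"] that by simp
  show ?thesis
  proof (intro adjunction.intro nat_trans.intro adjunction_axioms.intro nat_trans_axioms.intro
      is_functor_fctr_comp[OF F.is_functor_axioms G] is_functor_fctr_comp[OF G F.is_functor_axioms]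
      S.U.D.is_functor_fctr_id T.U.D.is_functor_fctr_id F.is_functor_axioms G)
    fix c assume "c \<in> Obj C"
    then show "amap V (\<epsilon> (omap J (omap F c))) \<cdot>\<^bsub>D\<^esub> amap F (amap U (\<eta> (omap I c))) = Ident D (omap F c)"
      using arg_cong[OF adj.triangle_left[of "omap I c"], of "amap V"] by simp
  next
    fix d assume "d \<in> Obj D"
    then show "amap (U \<circ>\<^sub>F P \<circ>\<^sub>F J) (amap V (\<epsilon> (omap J d))) \<cdot>\<^bsub>C\<^esub> amap U (\<eta> (omap I (omap (U \<circ>\<^sub>F P \<circ>\<^sub>F J) d)))
        = Ident C (omap (U \<circ>\<^sub>F P \<circ>\<^sub>F J) d)"
      using arg_cong[OF counit_unit_\<delta>[of "omap J d"], of "amap U"] by (simp del: counit_unit_\<delta>)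
  qed (use unit counit in \<open>auto simp: in_Hom\<close>)
qed

sublocale restricted: adjunction C D F "U \<circ>\<^sub>F P \<circ>\<^sub>F J" "\<lambda>c. amap U (\<eta> (omap I c))" "\<lambda>d. amap V (\<epsilon> (omap J d))"
  by (rule restricted_adjunction)

text \<open>
  For \<open>x\<close> in the subcategory, an algebra structure \<open>k\<close> on \<open>x\<close> yields one on \<open>U x\<close>: precompose
  with \<open>\<delta>\<close> to reach \<open>P (F' x)\<close> from the object \<open>P (J (F (U x)))\<close>, then apply \<open>U\<close>. Being a
  homomorphism can be tested on these restrictions, since both sides of the equation for a
  homomorphism start, after precomposition with an isomorphism, at an object of the subcategory
  and are determined by their images under \<open>U\<close>.
\<close>

lemma algebra_hom_iff_U:
  assumes x: "x \<in> Obj C'" "iso_arrow C' (\<delta> x)" and f: "f \<in> Hom C' x y"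
    and k: "k \<in> Hom C' (omap P (omap F' x)) x" and l: "l \<in> Hom C' (omap P (omap F' y)) y"
  shows "adj.algebra_hom x k y l f \<longleftrightarrow>
    restricted.algebra_hom (omap U x) (amap U (k \<cdot>\<^bsub>C'\<^esub> amap P (amap F' (\<delta> x))))
      (omap U y) (amap U (l \<cdot>\<^bsub>C'\<^esub> amap P (amap F' (\<delta> y)))) (amap U f)"
    (is "_ = restricted.algebra_hom _ ?k _ ?l _")
proof -
  have [simp]: "x \<in> Obj C'" "y \<in> Obj C'" "f \<in> Arr C'" "Dom C' f = x" "Cod C' f = y"
    "k \<in> Arr C'" "Dom C' k = omap P (omap F' x)" "Cod C' k = x"
    "l \<in> Arr C'" "Dom C' l = omap P (omap F' y)" "Cod C' l = y"
    using x f k l by (auto simp: in_Hom)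
  let ?d = "amap P (amap F' (\<delta> x))"
  have nat: "amap P (amap F' f) \<cdot>\<^bsub>C'\<^esub> ?d = amap P (amap F' (\<delta> y)) \<cdot>\<^bsub>C'\<^esub> amap P (amap J (amap F (amap U f)))"
    using arg_cong[OF S.\<delta>_natural[of f], of "\<lambda>h. amap P (amap F' h)"] by simp
  obtain e where e: "inverse_arrows C' (\<delta> x) e" using x(2) S.U.C.iso_arrow_inverse by blast
  have e': "inverse_arrows C' ?d (amap P (amap F' e))"
    by (rule adj.G.amap_inverse_arrows[OF F'.amap_inverse_arrows[OF e]])
  have "restricted.algebra_hom (omap U x) ?k (omap U y) ?l (amap U f) \<longleftrightarrow>
      amap U (f \<cdot>\<^bsub>C'\<^esub> k \<cdot>\<^bsub>C'\<^esub> ?d) = amap U (l \<cdot>\<^bsub>C'\<^esub> amap P (amap F' f) \<cdot>\<^bsub>C'\<^esub> ?d)"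
    unfolding nat by (simp add: restricted.algebra_hom_def in_Hom)
  also have "\<dots> \<longleftrightarrow> f \<cdot>\<^bsub>C'\<^esub> k \<cdot>\<^bsub>C'\<^esub> ?d = l \<cdot>\<^bsub>C'\<^esub> amap P (amap F' f) \<cdot>\<^bsub>C'\<^esub> ?d"
    (is "amap U ?a = amap U ?b \<longleftrightarrow> _")
  proof
    show "?a = ?b" if "amap U ?a = amap U ?b"
      by (rule S.eq_by_U[OF _ _ _ _ _ that]) (use iso_\<delta>_P_J in auto)
  qed simp
  also have "\<dots> \<longleftrightarrow> f \<cdot>\<^bsub>C'\<^esub> k = l \<cdot>\<^bsub>C'\<^esub> amap P (amap F' f)"
  proof
    assume "f \<cdot>\<^bsub>C'\<^esub> k \<cdot>\<^bsub>C'\<^esub> ?d = l \<cdot>\<^bsub>C'\<^esub> amap P (amap F' f) \<cdot>\<^bsub>C'\<^esub> ?d"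
    then have "(f \<cdot>\<^bsub>C'\<^esub> k \<cdot>\<^bsub>C'\<^esub> ?d) \<cdot>\<^bsub>C'\<^esub> amap P (amap F' e) = (l \<cdot>\<^bsub>C'\<^esub> amap P (amap F' f) \<cdot>\<^bsub>C'\<^esub> ?d) \<cdot>\<^bsub>C'\<^esub> amap P (amap F' e)"
      by simp
    then show "f \<cdot>\<^bsub>C'\<^esub> k = l \<cdot>\<^bsub>C'\<^esub> amap P (amap F' f)"
      using e e' by (simp add: inverse_arrows_def in_Hom)
  next
    assume eq: "f \<cdot>\<^bsub>C'\<^esub> k = l \<cdot>\<^bsub>C'\<^esub> amap P (amap F' f)"
    have "f \<cdot>\<^bsub>C'\<^esub> k \<cdot>\<^bsub>C'\<^esub> ?d = (f \<cdot>\<^bsub>C'\<^esub> k) \<cdot>\<^bsub>C'\<^esub> ?d" by simp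
    then show "f \<cdot>\<^bsub>C'\<^esub> k \<cdot>\<^bsub>C'\<^esub> ?d = l \<cdot>\<^bsub>C'\<^esub> amap P (amap F' f) \<cdot>\<^bsub>C'\<^esub> ?d"
      unfolding eq by simp
  qed
  finally show ?thesis by (simp add: adj.algebra_hom_def in_Hom)
qed

text \<open>
  Every algebra of the restricted monad on \<open>c\<close> comes from an algebra on \<open>I c\<close>: the structure is
  \<open>I h\<close> after the inverse of \<open>\<delta>\<close> at \<open>P (J (F c))\<close>, the carrier of the free algebra on \<open>I c\<close>. The two
  algebra laws hold because they hold after \<open>U\<close>.
\<close>

lemma lift_algebra:
  assumes "restricted.algebra c h"
  obtains k where "adj.algebra (omap I c) k" "amap U k = h"
proof -
  have eqs: "h \<cdot>\<^bsub>C\<^esub> amap U (\<eta> (omap I c)) = Ident C c"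
    "h \<cdot>\<^bsub>C\<^esub> amap U (amap P (amap J (amap F h))) = h \<cdot>\<^bsub>C\<^esub> amap U (amap P (amap J (amap V (\<epsilon> (omap J (omap F c))))))"
    and [simp]: "c \<in> Obj C" "h \<in> Arr C" "Dom C h = omap U (omap P (omap J (omap F c)))" "Cod C h = c"
    using assms by (auto simp: restricted.algebra_def in_Hom)
  let ?d = "\<delta> (omap P (omap J (omap F c)))"
  obtain e where e: "inverse_arrows C' ?d e"
    using iso_\<delta>_P_J[of "omap F c"] S.U.C.iso_arrow_inverse by auto
  have [simp]: "e \<in> Arr C'" "Dom C' e = omap P (omap J (omap F c))"
    "Cod C' e = omap I (omap U (omap P (omap J (omap F c))))" "e \<cdot>\<^bsub>C'\<^esub> ?d = Ident C' (omap I (omap U (omap P (omap J (omap F c)))))"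
    "amap U e = Ident C (omap U (omap P (omap J (omap F c))))"
    using e S.U_inverse_\<delta>[OF _ e] by (auto simp: inverse_arrows_def in_Hom)
  define k where "k = amap I h \<cdot>\<^bsub>C'\<^esub> e"
  have k [simp]: "k \<in> Arr C'" "Dom C' k = omap P (omap J (omap F c))" "Cod C' k = omap I c" "amap U k = h"
    and kd: "k \<cdot>\<^bsub>C'\<^esub> ?d = amap I h"
    by (auto simp: k_def)
  have "k \<cdot>\<^bsub>C'\<^esub> \<eta> (omap I c) = Ident C' (omap I c)"
    by (rule S.eq_by_U) (auto simp: eqs iso_arrow_def in_Hom intro!: bexI[of _ "Ident C' (omap I c)"])
  moreover have "k \<cdot>\<^bsub>C'\<^esub> amap P (amap F' k) = k \<cdot>\<^bsub>C'\<^esub> amap P (\<epsilon> (omap J (omap F c)))"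
  proof -
    let ?Pd = "amap P (amap F' ?d)" and ?Pe = "amap P (amap F' e)"
    have Pd: "?Pd \<cdot>\<^bsub>C'\<^esub> ?Pe = Ident C' (omap P (omap F' (omap P (omap J (omap F c)))))"
      using adj.G.amap_inverse_arrows[OF F'.amap_inverse_arrows[OF e]]
      by (auto simp: inverse_arrows_def in_Hom)
    have "amap P (amap F' k) \<cdot>\<^bsub>C'\<^esub> ?Pd = amap P (amap J (amap F h))"
      using arg_cong[OF kd, of "\<lambda>h. amap P (amap F' h)"] by simp
    then have "k \<cdot>\<^bsub>C'\<^esub> amap P (amap F' k) \<cdot>\<^bsub>C'\<^esub> ?Pd = k \<cdot>\<^bsub>C'\<^esub> amap P (\<epsilon> (omap J (omap F c))) \<cdot>\<^bsub>C'\<^esub> ?Pd"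
      using eqs(2) iso_\<delta>_P_J by (auto intro!: S.eq_by_U)
    then have "(k \<cdot>\<^bsub>C'\<^esub> amap P (amap F' k) \<cdot>\<^bsub>C'\<^esub> ?Pd) \<cdot>\<^bsub>C'\<^esub> ?Pe = (k \<cdot>\<^bsub>C'\<^esub> amap P (\<epsilon> (omap J (omap F c))) \<cdot>\<^bsub>C'\<^esub> ?Pd) \<cdot>\<^bsub>C'\<^esub> ?Pe"
      by simp
    then show ?thesis using Pd by simp
  qed
  ultimately have "adj.algebra (omap I c) k"
    by (simp add: adj.algebra_def in_Hom)
  then show thesis using that k(4) by blast
qed

text \<open>
  If \<open>P g\<close> lies in the subcategory, replacing \<open>g\<close> by its coreflection \<open>J (V g)\<close> does not change
  \<open>P g\<close>. The inverse is the transpose of \<open>J (V (\<epsilon> g))\<close>, composed with the inverse of \<open>\<delta>\<close>; both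
  equations are checked after \<open>U\<close>.
\<close>

lemma P_\<gamma>_inverse:
  assumes g [simp]: "g \<in> Obj D'" and iso: "iso_arrow C' (\<delta> (omap P g))"
  shows "\<exists>n. inverse_arrows C' (amap P (\<gamma> g)) n"
proof -
  obtain e where e: "inverse_arrows C' (\<delta> (omap P g)) e"
    using iso S.U.C.iso_arrow_inverse by blast
  have [simp]: "e \<in> Arr C'" "Dom C' e = omap P g" "Cod C' e = omap I (omap U (omap P g))"
    "amap U e = Ident C (omap U (omap P g))"
    using e S.U_inverse_\<delta>[OF _ e] by (auto simp: inverse_arrows_def in_Hom)
  \<comment> \<open>The transpose of \<open>J (V (\<epsilon> g))\<close>, whose source is \<open>J (V (F' (P g))) = F' (I (U (P g)))\<close>.\<close>
  let ?r = "amap P (amap J (amap V (\<epsilon> g))) \<cdot>\<^bsub>C'\<^esub> \<eta> (omap I (omap U (omap P g)))"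
  define n where "n = ?r \<cdot>\<^bsub>C'\<^esub> e"
  have n [simp]: "n \<in> Arr C'" "Dom C' n = omap P g" "Cod C' n = omap P (omap J (omap V g))" "amap U n = amap U ?r"
    by (auto simp: n_def)
  have "amap P (\<gamma> g) \<cdot>\<^bsub>C'\<^esub> n = Ident C' (omap P g)"
  proof (rule S.eq_by_U)
    have "amap P (\<gamma> g) \<cdot>\<^bsub>C'\<^esub> ?r = (amap P (\<gamma> g \<cdot>\<^bsub>D'\<^esub> amap J (amap V (\<epsilon> g)))) \<cdot>\<^bsub>C'\<^esub> \<eta> (omap I (omap U (omap P g)))"
      by simp
    also have "\<dots> = \<delta> (omap P g)"
      unfolding \<gamma>_counit[OF g] by simp
    finally have "amap U (amap P (\<gamma> g) \<cdot>\<^bsub>C'\<^esub> ?r) = amap U (\<delta> (omap P g))" by simp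
    then show "amap U (amap P (\<gamma> g) \<cdot>\<^bsub>C'\<^esub> n) = amap U (Ident C' (omap P g))"
      by simp
  qed (use iso in auto)
  moreover have "n \<cdot>\<^bsub>C'\<^esub> amap P (\<gamma> g) = Ident C' (omap P (omap J (omap V g)))"
  proof (rule S.eq_by_U)
    let ?j = "omap J (omap V g)"
    have unit: "amap U (\<eta> (omap I (omap U (omap P g)))) \<cdot>\<^bsub>C\<^esub> amap U (amap P (\<gamma> g))
        = amap U (amap P (amap J (amap F (amap U (amap P (\<gamma> g)))))) \<cdot>\<^bsub>C\<^esub> amap U (\<eta> (omap I (omap U (omap P ?j))))"
      using restricted.unit_natural[of "amap U (amap P (\<gamma> g))"] by simp
    \<comment> \<open>Naturality of \<open>\<epsilon>\<close> at \<open>\<gamma> g\<close>, where \<open>V\<close> sends \<open>\<gamma> g\<close> to an identity.\<close>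
    have "amap V (\<epsilon> g) \<cdot>\<^bsub>D\<^esub> amap F (amap U (amap P (\<gamma> g))) = amap V (\<epsilon> ?j)"
      using arg_cong[OF adj.counit_natural[of "\<gamma> g"], of "amap V"] by simp
    then have counit: "amap U (amap P (amap J (amap V (\<epsilon> g)))) \<cdot>\<^bsub>C\<^esub> amap U (amap P (amap J (amap F (amap U (amap P (\<gamma> g))))))
        = amap U (amap P (amap J (amap V (\<epsilon> ?j))))"
      by (simp del: J_V_counit flip: adj.G.amap_Comp S.U.amap_Comp T.I.amap_Comp)
    have "amap U (n \<cdot>\<^bsub>C'\<^esub> amap P (\<gamma> g))
        = (amap U (amap P (amap J (amap V (\<epsilon> g)))) \<cdot>\<^bsub>C\<^esub> amap U (amap P (amap J (amap F (amap U (amap P (\<gamma> g)))))))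
           \<cdot>\<^bsub>C\<^esub> amap U (\<eta> (omap I (omap U (omap P ?j))))"
      using unit by simp
    also have "\<dots> = Ident C (omap U (omap P ?j))"
      unfolding counit using restricted.triangle_r[of "omap V g"] by simp
    finally show "amap U (n \<cdot>\<^bsub>C'\<^esub> amap P (\<gamma> g)) = amap U (Ident C' (omap P ?j))" by simp
  qed (use iso_\<delta>_P_J in auto)
  ultimately show ?thesis
    by (auto simp: inverse_arrows_def in_Hom intro!: exI[of _ n])
qed

text \<open>
  Between objects of the subcategory, arrows and algebra homomorphisms correspond bijectively to
  their images under the coreflection, so faithfulness and fullness are inherited. For
  essential surjectivity, an algebra on \<open>c\<close> is lifted to one on \<open>I c\<close>, which by monadicity of \<open>P\<close> is isomorphic to \<open>P g\<close> for some \<open>g\<close>. This \<open>g\<close> need not lie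
  in the subcategory a priori, but its coreflection \<open>J (V g)\<close> has the same image under \<open>P\<close>, so the
  object \<open>V g\<close> presents the given algebra.
\<close>

theorem restricted_monadic:
  assumes "adj.monadic"
  shows "restricted.monadic"
  unfolding restricted.monadic_def
proof (intro conjI ballI impI allI)
  note m = assms[unfolded adj.monadic_def]
  fix f g assume fg: "f \<in> Arr D" "g \<in> Arr D" "Dom D f = Dom D g" "Cod D f = Cod D g"
    "amap (U \<circ>\<^sub>F P \<circ>\<^sub>F J) f = amap (U \<circ>\<^sub>F P \<circ>\<^sub>F J) g"
  have "amap P (amap J f) = amap P (amap J g)"
    by (rule S.eq_by_U) (use fg iso_\<delta>_P_J in auto)
  then have "amap J f = amap J g" using fg m by auto
  then have "amap V (amap J f) = amap V (amap J g)" by simp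
  then show "f = g" using fg by simp
next
  note m = assms[unfolded adj.monadic_def]
  let ?G = "U \<circ>\<^sub>F P \<circ>\<^sub>F J" and ?e = "\<lambda>d. amap V (\<epsilon> (omap J d))"
  fix x y h
  assume [simp]: "x \<in> Obj D" "y \<in> Obj D" and h: "restricted.algebra_hom (omap ?G x) (amap ?G (?e x)) (omap ?G y) (amap ?G (?e y)) h"
  then have [simp]: "h \<in> Arr C" "Dom C h = omap U (omap P (omap J x))" "Cod C h = omap U (omap P (omap J y))"
    by (auto simp: restricted.algebra_hom_def in_Hom)
  obtain e where e: "inverse_arrows C' (\<delta> (omap P (omap J x))) e"
    using iso_\<delta>_P_J[of x] S.U.C.iso_arrow_inverse by auto
  have [simp]: "e \<in> Arr C'" "Dom C' e = omap P (omap J x)" "Cod C' e = omap I (omap U (omap P (omap J x)))"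
    "amap U e = Ident C (omap U (omap P (omap J x)))"
    using e S.U_inverse_\<delta>[OF _ e] by (auto simp: inverse_arrows_def in_Hom)
  \<comment> \<open>Transporting \<open>I h\<close> along the isomorphisms \<open>\<delta>\<close> gives an arrow with image \<open>h\<close> under \<open>U\<close>.\<close>
  define k where "k = \<delta> (omap P (omap J y)) \<cdot>\<^bsub>C'\<^esub> amap I h \<cdot>\<^bsub>C'\<^esub> e"
  have k: "k \<in> Hom C' (omap P (omap J x)) (omap P (omap J y))" "amap U k = h"
    by (auto simp: k_def in_Hom)
  note [simp] = k(1)[unfolded in_Hom] k(2)
  have "adj.algebra_hom (omap P (omap J x)) (amap P (\<epsilon> (omap J x))) (omap P (omap J y)) (amap P (\<epsilon> (omap J y))) k"
    using h iso_\<delta>_P_J by (subst algebra_hom_iff_U) (auto simp: in_Hom)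
  then obtain f where f: "f \<in> Hom D' (omap J x) (omap J y)" "amap P f = k"
    using m by fastforce
  then have "amap J (amap V f) = f"
    using T.\<delta>_natural[of f] by (auto simp: in_Hom)
  moreover have "amap U (amap P f) = h" using f(2) k(2) by simp
  ultimately show "\<exists>f \<in> Hom D x y. amap ?G f = h"
    using f(1) by (auto simp: in_Hom intro!: bexI[of _ "amap V f"])
next
  note m = assms[unfolded adj.monadic_def]
  let ?G = "U \<circ>\<^sub>F P \<circ>\<^sub>F J" and ?e = "\<lambda>d. amap V (\<epsilon> (omap J d))"
  fix c h assume h: "restricted.algebra c h"
  then have [simp]: "c \<in> Obj C" by (simp add: restricted.algebra_def)
  obtain k where k: "adj.algebra (omap I c) k" "amap U k = h"
    using lift_algebra[OF h] .
  then have k': "k \<in> Hom C' (omap P (omap F' (omap I c))) (omap I c)" by (simp add: adj.algebra_def)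
  obtain g q where g [simp]: "g \<in> Obj D'"
    and q: "adj.algebra_hom (omap P g) (amap P (\<epsilon> g)) (omap I c) k q" "iso_arrow C' q"
    using m k(1) by blast
  obtain q' where q': "inverse_arrows C' q q'" using q(2) S.U.C.iso_arrow_inverse by blast
  have [simp]: "q \<in> Arr C'" "Dom C' q = omap P g" "Cod C' q = omap I c"
    using q by (auto simp: adj.algebra_hom_def in_Hom)
  have "iso_arrow C' (\<delta> (omap I c))"
    by (auto simp: iso_arrow_def in_Hom intro!: bexI[of _ "Ident C' (omap I c)"])
  then have "iso_arrow C' (\<delta> (omap P g))"
    using S.iso_\<delta>_transfer[OF q'] by simp
  from P_\<gamma>_inverse[OF g this] obtain n where n: "inverse_arrows C' (amap P (\<gamma> g)) n" ..
  let ?y = "omap V g"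
  let ?w = "q \<cdot>\<^bsub>C'\<^esub> amap P (\<gamma> g)"
  have "adj.algebra_hom (omap P (omap J ?y)) (amap P (\<epsilon> (omap J ?y))) (omap P g) (amap P (\<epsilon> g)) (amap P (\<gamma> g))"
    using adj.algebra_hom_amap[of "\<gamma> g"] by simp
  then have "adj.algebra_hom (omap P (omap J ?y)) (amap P (\<epsilon> (omap J ?y))) (omap I c) k ?w"
    using adj.algebra_hom_Compose[OF adj.algebra_free_on adj.algebra_free_on k(1) _ q(1)] by simp
  then have "restricted.algebra_hom (omap ?G ?y) (amap ?G (?e ?y)) c h (amap U ?w)"
    using iso_\<delta>_P_J k k' by (subst (asm) algebra_hom_iff_U) (auto simp: in_Hom)
  moreover have "inverse_arrows C' ?w (n \<cdot>\<^bsub>C'\<^esub> q')"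
    by (rule S.U.C.inverse_arrows_Compose[OF n q']) simp
  then have "iso_arrow C (amap U ?w)"
    using S.U.amap_inverse_arrows S.U.D.iso_arrow_inverse by blast
  ultimately show "\<exists>y \<in> Obj D. \<exists>m. restricted.algebra_hom (omap ?G y) (amap ?G (?e y)) c h m \<and> iso_arrow C m"
    by (intro bexI[of _ ?y]) auto
qed

end

section \<open>Slices of a coreflection\<close>

lemma slice_simps [simp]:
  "Obj (slice X b) = {f \<in> Arr X. Cod X f = b}"
  "Dom (slice X b) = src" "Cod (slice X b) = tgt"
  "Ident (slice X b) f = Tag f (Ident X (Dom X f)) f"
  "u \<cdot>\<^bsub>slice X b\<^esub> t = Tag (src t) (lab u \<cdot>\<^bsub>X\<^esub> lab t) (tgt u)"
  by (simp_all add: slice_def hom_category_def)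

lemma Arr_slice [simp]:
  "t \<in> Arr (slice X b) \<longleftrightarrow>
     src t \<in> Arr X \<and> Cod X (src t) = b \<and> tgt t \<in> Arr X \<and> Cod X (tgt t) = b \<and>
     lab t \<in> Arr X \<and> Dom X (lab t) = Dom X (src t) \<and> Cod X (lab t) = Dom X (tgt t) \<and>
     tgt t \<cdot>\<^bsub>X\<^esub> lab t = src t"
  by (cases t) (auto simp: slice_def hom_category_def in_Hom)

lemma (in category) category_slice: "category (slice C b)"
  unfolding slice_def
proof (rule category_hom_category)
  let ?ob = "{f \<in> Arr C. Cod C f = b}"
  let ?hom = "\<lambda>f g. {h \<in> Hom C (Dom C f) (Dom C g). g \<cdot>\<^bsub>C\<^esub> h = f}"
  show "g \<cdot>\<^bsub>C\<^esub> f \<in> ?hom x z"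
    if "x \<in> ?ob" "y \<in> ?ob" "z \<in> ?ob" "f \<in> ?hom x y" "g \<in> ?hom y z" for x y z f g
  proof -
    have "z \<cdot>\<^bsub>C\<^esub> g \<cdot>\<^bsub>C\<^esub> f = (z \<cdot>\<^bsub>C\<^esub> g) \<cdot>\<^bsub>C\<^esub> f"
      using that by (subst assoc) (auto simp: in_Hom)
    also have "\<dots> = x" using that by simp
    finally show ?thesis using that by (simp add: in_Hom)
  qed
qed (auto simp: in_Hom)

text \<open>
  Associativity for the triangle \<open>tgt t \<cdot> lab t = src t\<close>, which right-normalisation of
  composites would otherwise hide.
\<close>

lemma (in category) slice_reassoc:
  assumes "t \<in> Arr (slice C b)" "h \<in> Arr C" "Cod C h = Dom C (lab t)"
  shows "tgt t \<cdot>\<^bsub>C\<^esub> lab t \<cdot>\<^bsub>C\<^esub> h = src t \<cdot>\<^bsub>C\<^esub> h"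
proof -
  have "tgt t \<cdot>\<^bsub>C\<^esub> lab t \<cdot>\<^bsub>C\<^esub> h = (tgt t \<cdot>\<^bsub>C\<^esub> lab t) \<cdot>\<^bsub>C\<^esub> h"
    using assms by (subst assoc) auto
  also have "tgt t \<cdot>\<^bsub>C\<^esub> lab t = src t"
    using assms(1) by simp
  finally show ?thesis .
qed

lemma (in category) iso_arrow_slice:
  assumes "t \<in> Arr (slice C b)" "iso_arrow C (lab t)"
  shows "iso_arrow (slice C b) t"
proof -
  obtain e where e: "inverse_arrows C (lab t) e" using assms(2) iso_arrow_inverse by blast
  then have e': "e \<in> Arr C" "Dom C e = Cod C (lab t)" "Cod C e = Dom C (lab t)"
    "lab t \<cdot>\<^bsub>C\<^esub> e = Ident C (Cod C (lab t))" "e \<cdot>\<^bsub>C\<^esub> lab t = Ident C (Dom C (lab t))"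
    by (auto simp: inverse_arrows_def in_Hom)
  have "src t \<cdot>\<^bsub>C\<^esub> e = tgt t"
    using assms(1) e' slice_reassoc[OF assms(1), of e] by simp
  then show ?thesis
    using assms(1) e' by (auto simp: iso_arrow_def in_Hom intro!: bexI[of _ "Tag (tgt t) e (src t)"])
qed

lemma (in category) slice_push_functor:
  assumes "p \<in> Arr C"
  shows "is_functor (slice C (Dom C p)) (slice C (Cod C p)) (slice_push C p)"
  by (intro is_functor.intro is_functor_axioms.intro category_slice)
     (use assms in \<open>auto simp: slice_push_def in_Hom\<close>)

definition slice_map :: "('o, 'm, 'p, 'n) fctr \<Rightarrow> ('m, ('m, 'm) tagged, 'n, ('n, 'n) tagged) fctr" where
  "slice_map F = \<lparr>omap = amap F, amap = (\<lambda>t. Tag (amap F (src t)) (amap F (lab t)) (amap F (tgt t)))\<rparr>"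

lemma slice_map_simps [simp]:
  "omap (slice_map F) = amap F"
  "amap (slice_map F) t = Tag (amap F (src t)) (amap F (lab t)) (amap F (tgt t))"
  by (simp_all add: slice_map_def)

lemma slice_push_simps [simp]:
  "omap (slice_push X p) f = p \<cdot>\<^bsub>X\<^esub> f"
  "amap (slice_push X p) t = Tag (p \<cdot>\<^bsub>X\<^esub> src t) (lab t) (p \<cdot>\<^bsub>X\<^esub> tgt t)"
  by (simp_all add: slice_push_def)

lemma (in is_functor) slice_map_functor: "is_functor (slice C b) (slice D (omap F b)) (slice_map F)"
proof (intro is_functor.intro is_functor_axioms.intro C.category_slice D.category_slice)
  fix f x y assume "f \<in> Hom (slice C b) x y"
  then show "amap (slice_map F) f \<in> Hom (slice D (omap F b)) (omap (slice_map F) x) (omap (slice_map F) y)"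
    using amap_Comp[of "lab f" "tgt f"] by (auto simp: in_Hom simp del: amap_Comp)
qed (auto simp: in_Hom)

context split_coreflection
begin

text \<open>
  The left adjoint of \<open>slice_map U\<close> over \<open>b\<close>: an arrow \<open>h\<close> into \<open>U b\<close> corresponds to the arrow
  \<open>\<delta> b \<cdot> I h\<close> from \<open>I (Dom h)\<close> to \<open>b\<close>.
\<close>

definition slice_section where
  "slice_section b = slice_push X (\<delta> b) \<circ>\<^sub>F slice_map I"

definition slice_counit where
  "slice_counit b g = Tag (\<delta> b \<cdot>\<^bsub>X\<^esub> amap I (amap U g)) (\<delta> (Dom X g)) g"

lemma slice_section_simps [simp]:
  "omap (slice_section b) h = \<delta> b \<cdot>\<^bsub>X\<^esub> amap I h"
  "amap (slice_section b) t = Tag (\<delta> b \<cdot>\<^bsub>X\<^esub> amap I (src t)) (amap I (lab t)) (\<delta> b \<cdot>\<^bsub>X\<^esub> amap I (tgt t))"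
  by (simp_all add: slice_section_def)

lemma slice_split_coreflection:
  assumes [simp]: "b \<in> Obj X"
  shows "split_coreflection (slice X b) (slice A (omap U b)) (slice_map U) (slice_section b) (slice_counit b)"
proof (intro split_coreflection.intro split_coreflection_axioms.intro)
  show "is_functor (slice X b) (slice A (omap U b)) (slice_map U)"
    by (rule U.slice_map_functor)
  have "is_functor (slice A (omap U b)) (slice X (omap I (omap U b))) (slice_map I)"
    by (rule I.slice_map_functor)
  moreover have "is_functor (slice X (omap I (omap U b))) (slice X b) (slice_push X (\<delta> b))"
    using U.C.slice_push_functor[of "\<delta> b"] by simp
  ultimately show "is_functor (slice A (omap U b)) (slice X b) (slice_section b)"
    unfolding slice_section_def by (rule is_functor_fctr_comp)
next
  fix g assume "g \<in> Arr (slice X b)"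
  then show "g \<cdot>\<^bsub>slice X b\<^esub> slice_counit b (Dom (slice X b) g)
      = slice_counit b (Cod (slice X b) g) \<cdot>\<^bsub>slice X b\<^esub> amap (slice_section b) (amap (slice_map U) g)"
    using \<delta>_natural[of "lab g"] by (simp add: slice_counit_def)
next
  fix g assume "g \<in> Obj (slice X b)"
  then show "slice_counit b g \<in> Hom (slice X b) (omap (slice_section b) (omap (slice_map U) g)) g"
    using \<delta>_natural[of g] by (auto simp: slice_counit_def in_Hom)
qed (auto simp: slice_counit_def tagged.expand)

text \<open>
  Right adjoints preserve limits, so the image under \<open>U\<close> of a pullback is a pullback. An arrow \<open>g\<close>
  into \<open>U (Cod p)\<close> is the image of its transpose \<open>\<delta> \<cdot> I g\<close>, so the image of the pullback of
  this transpose along \<open>p\<close> is the required pullback of \<open>g\<close>.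
\<close>

lemma pullbacks_along_U:
  assumes p [simp]: "p \<in> Arr X" and "pullbacks_along_exist X p"
  shows "pullbacks_along_exist A (amap U p)"
  unfolding pullbacks_along_exist_def
proof (intro ballI impI)
  fix g assume g [simp]: "g \<in> Arr A" "Cod A g = Cod A (amap U p)"
  let ?b = "Cod X p"
  define g' where "g' = \<delta> ?b \<cdot>\<^bsub>X\<^esub> amap I g"
  have g' [simp]: "g' \<in> Arr X" "Dom X g' = omap I (Dom A g)" "Cod X g' = ?b" "amap U g' = g"
    by (auto simp: g'_def)
  obtain q r where qr: "is_pullback X p g' q r"
    using assms unfolding pullbacks_along_exist_def by fastforce
  then have [simp]: "q \<in> Arr X" "r \<in> Arr X" "Dom X q = Dom X r" "Cod X q = omap I (Dom A g)" "Cod X r = Dom X p"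
    and comm: "p \<cdot>\<^bsub>X\<^esub> r = g' \<cdot>\<^bsub>X\<^esub> q"
    by (simp_all add: is_pullback_def)
  from qr have univ: "\<And>w u v. \<lbrakk>w \<in> Obj X; u \<in> Hom X w (Dom X p); v \<in> Hom X w (Dom X g'); p \<cdot>\<^bsub>X\<^esub> u = g' \<cdot>\<^bsub>X\<^esub> v\<rbrakk>
      \<Longrightarrow> \<exists>!t. t \<in> Hom X w (Dom X q) \<and> r \<cdot>\<^bsub>X\<^esub> t = u \<and> q \<cdot>\<^bsub>X\<^esub> t = v"
    unfolding is_pullback_def by blast
  have "is_pullback A (amap U p) g (amap U q) (amap U r)"
    unfolding is_pullback_def
  proof (intro conjI ballI impI)
    show "amap U p \<cdot>\<^bsub>A\<^esub> amap U r = g \<cdot>\<^bsub>A\<^esub> amap U q"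
      using arg_cong[OF comm, of "amap U"] by simp
  next
    fix w u v
    assume w [simp]: "w \<in> Obj A" and u: "u \<in> Hom A w (Dom A (amap U p))" and v: "v \<in> Hom A w (Dom A g)"
      and uv: "amap U p \<cdot>\<^bsub>A\<^esub> u = g \<cdot>\<^bsub>A\<^esub> v"
    note [simp] = u[unfolded in_Hom] v[unfolded in_Hom]
    define u' where "u' = \<delta> (Dom X p) \<cdot>\<^bsub>X\<^esub> amap I u"
    have "p \<cdot>\<^bsub>X\<^esub> u' = (p \<cdot>\<^bsub>X\<^esub> \<delta> (Dom X p)) \<cdot>\<^bsub>X\<^esub> amap I u" by (simp add: u'_def)
    also have "\<dots> = \<delta> ?b \<cdot>\<^bsub>X\<^esub> amap I (amap U p \<cdot>\<^bsub>A\<^esub> u)"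
      using \<delta>_natural[OF p] by simp
    also have "\<dots> = g' \<cdot>\<^bsub>X\<^esub> amap I v"
      unfolding uv by (simp add: g'_def)
    finally have "\<exists>!t. t \<in> Hom X (omap I w) (Dom X q) \<and> r \<cdot>\<^bsub>X\<^esub> t = u' \<and> q \<cdot>\<^bsub>X\<^esub> t = amap I v"
      by (intro univ) (auto simp: in_Hom u'_def)
    then obtain t where t: "t \<in> Hom X (omap I w) (Dom X q)" "r \<cdot>\<^bsub>X\<^esub> t = u'" "q \<cdot>\<^bsub>X\<^esub> t = amap I v"
      and unique: "\<And>s. \<lbrakk>s \<in> Hom X (omap I w) (Dom X q); r \<cdot>\<^bsub>X\<^esub> s = u'; q \<cdot>\<^bsub>X\<^esub> s = amap I v\<rbrakk> \<Longrightarrow> s = t"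
      by blast
    note [simp] = t(1)[unfolded in_Hom]
    show "\<exists>!t. t \<in> Hom A w (Dom A (amap U q)) \<and> amap U r \<cdot>\<^bsub>A\<^esub> t = u \<and> amap U q \<cdot>\<^bsub>A\<^esub> t = v"
    proof (rule ex1I[of _ "amap U t"])
      show "amap U t \<in> Hom A w (Dom A (amap U q)) \<and> amap U r \<cdot>\<^bsub>A\<^esub> amap U t = u \<and> amap U q \<cdot>\<^bsub>A\<^esub> amap U t = v"
        using arg_cong[OF t(2), of "amap U"] arg_cong[OF t(3), of "amap U"] by (simp add: in_Hom u'_def)
    next
      fix s assume s: "s \<in> Hom A w (Dom A (amap U q)) \<and> amap U r \<cdot>\<^bsub>A\<^esub> s = u \<and> amap U q \<cdot>\<^bsub>A\<^esub> s = v"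
      then have [simp]: "s \<in> Arr A" "Dom A s = w" "Cod A s = omap U (Dom X r)" by (auto simp: in_Hom)
      \<comment> \<open>The transpose of \<open>s\<close>, to which uniqueness of \<open>t\<close> applies.\<close>
      let ?s = "\<delta> (Dom X q) \<cdot>\<^bsub>X\<^esub> amap I s"
      have *: "f \<cdot>\<^bsub>X\<^esub> ?s = \<delta> (Cod X f) \<cdot>\<^bsub>X\<^esub> amap I (amap U f \<cdot>\<^bsub>A\<^esub> s)" if "f \<in> Arr X" "Dom X f = Dom X q" for f
      proof -
        have "f \<cdot>\<^bsub>X\<^esub> ?s = (f \<cdot>\<^bsub>X\<^esub> \<delta> (Dom X f)) \<cdot>\<^bsub>X\<^esub> amap I s" using that by simp
        then show ?thesis unfolding \<delta>_natural[OF that(1)] using that by simp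
      qed
      have "?s = t"
      proof (rule unique)
        show "r \<cdot>\<^bsub>X\<^esub> ?s = u'" by (subst *) (use s in \<open>auto simp: u'_def\<close>)
        show "q \<cdot>\<^bsub>X\<^esub> ?s = amap I v" by (subst *) (use s in auto)
      qed (simp add: in_Hom)
      from arg_cong[OF this, of "amap U"] show "s = amap U t" by simp
    qed
  qed auto
  then show "\<exists>q r. is_pullback A (amap U p) g q r" by blast
qed

lemma slice_square:
  assumes [simp]: "p \<in> Arr X"
  shows "coreflective_square
    (slice X (Dom X p)) (slice A (omap U (Dom X p))) (slice_map U) (slice_section (Dom X p)) (slice_counit (Dom X p))
    (slice X (Cod X p)) (slice A (omap U (Cod X p))) (slice_map U) (slice_section (Cod X p)) (slice_counit (Cod X p))
    (slice_push A (amap U p)) (slice_push X p)"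
proof (intro coreflective_square.intro coreflective_square_axioms.intro slice_split_coreflection U.C.slice_push_functor)
  show "is_functor (slice A (omap U (Dom X p))) (slice A (omap U (Cod X p))) (slice_push A (amap U p))"
    using U.D.slice_push_functor[of "amap U p"] by simp
  have natural: "p \<cdot>\<^bsub>X\<^esub> \<delta> (Dom X p) \<cdot>\<^bsub>X\<^esub> amap I h = \<delta> (Cod X p) \<cdot>\<^bsub>X\<^esub> amap I (amap U p) \<cdot>\<^bsub>X\<^esub> amap I h"
    if "h \<in> Arr A" "Cod A h = omap U (Dom X p)" for h
  proof -
    have "p \<cdot>\<^bsub>X\<^esub> \<delta> (Dom X p) \<cdot>\<^bsub>X\<^esub> amap I h = (p \<cdot>\<^bsub>X\<^esub> \<delta> (Dom X p)) \<cdot>\<^bsub>X\<^esub> amap I h"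
      using that by simp
    then show ?thesis unfolding \<delta>_natural[OF assms] using that by simp
  qed
  show "omap (slice_push X p) (omap (slice_section (Dom X p)) h)
      = omap (slice_section (Cod X p)) (omap (slice_push A (amap U p)) h)"
    if "h \<in> Obj (slice A (omap U (Dom X p)))" for h
    using that natural by simp
  show "amap (slice_push X p) (amap (slice_section (Dom X p)) t)
      = amap (slice_section (Cod X p)) (amap (slice_push A (amap U p)) t)"
    if "t \<in> Arr (slice A (omap U (Dom X p)))" for t
    using that natural by simp
  show "slice_counit (Cod X p) (omap (slice_push X p) g) = amap (slice_push X p) (slice_counit (Dom X p) g)"
    if "g \<in> Obj (slice X (Dom X p))" for g
    using that natural[of "amap U g"] by (simp add: slice_counit_def)
qed auto

end

text \<open>
  Strictness: the subcategory is closed, up to isomorphism, under the sources of arrows into it.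
\<close>

locale strict_coreflection = split_coreflection +
  assumes strict: "\<lbrakk>x \<in> Obj X; a \<in> Obj A; Hom X x (omap I a) \<noteq> {}\<rbrakk> \<Longrightarrow> iso_arrow X (\<delta> x)"
begin

text \<open>
  Strictness is what makes pullback along \<open>p\<close> restrict to the subcategories of the slices: the
  counit of the pullback of \<open>\<delta> \<cdot> I d\<close> is an arrow from its source to \<open>I (Dom d)\<close>, so that source lies
  in the subcategory.
\<close>

theorem preserves_effective_descent: "preserves_effective_descent X A U"
  unfolding preserves_effective_descent_def
proof (intro allI impI)
  fix p assume p: "effective_descent X p"
  let ?a = "Dom X p" and ?b = "Cod X p"
  obtain P \<eta> \<epsilon> where [simp]: "p \<in> Arr X" and pb: "pullbacks_along_exist X p"
    and m: "monadic_adjunction (slice X ?a) (slice X ?b) (slice_push X p) P \<eta> \<epsilon>"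
    using p unfolding effective_descent_def by blast
  interpret sq: coreflective_square
    "slice X ?a" "slice A (omap U ?a)" "slice_map U" "slice_section ?a" "slice_counit ?a"
    "slice X ?b" "slice A (omap U ?b)" "slice_map U" "slice_section ?b" "slice_counit ?b"
    "slice_push A (amap U p)" "slice_push X p"
    by (rule slice_square) simp
  interpret adj: adjunction "slice X ?a" "slice X ?b" "slice_push X p" P \<eta> \<epsilon>
    using m by (simp add: monadic_adjunction_def)
  interpret sq: coreflective_square_adjunction
    "slice X ?a" "slice A (omap U ?a)" "slice_map U" "slice_section ?a" "slice_counit ?a"
    "slice X ?b" "slice A (omap U ?b)" "slice_map U" "slice_section ?b" "slice_counit ?b"
    "slice_push A (amap U p)" "slice_push X p" P \<eta> \<epsilon>
  proof
    fix d assume d: "d \<in> Obj (slice A (omap U ?b))"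
    define j where "j = omap (slice_section ?b) d"
    have j: "j \<in> Obj (slice X ?b)" "Dom X j = omap I (Dom A d)"
      using d by (auto simp: j_def)
    \<comment> \<open>The counit at \<open>j\<close> is an arrow from the source of \<open>g\<close> to \<open>I (Dom d)\<close>, so strictness applies.\<close>
    define g where "g = omap P j"
    have g: "g \<in> Obj (slice X ?a)" unfolding g_def by (rule adj.G.omap_Obj[OF j(1)])
    have "\<epsilon> j \<in> Arr (slice X ?b)" "src (\<epsilon> j) = p \<cdot>\<^bsub>X\<^esub> g" "tgt (\<epsilon> j) = j"
      using adj.counit.component_Arr[OF j(1)] by (simp_all add: g_def)
    then have "lab (\<epsilon> j) \<in> Hom X (Dom X g) (omap I (Dom A d))"
      using g j by (auto simp: in_Hom)
    then have "iso_arrow X (\<delta> (Dom X g))"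
      using strict[of "Dom X g" "Dom A d"] g d by auto
    moreover have "slice_counit ?a g \<in> Arr (slice X ?a)"
      by (rule sq.S.\<delta>_Arr(1)[OF g])
    ultimately show "iso_arrow (slice X ?a) (slice_counit ?a (omap P (omap (slice_section ?b) d)))"
      unfolding g_def[symmetric] j_def[symmetric]
      by (intro U.C.iso_arrow_slice) (auto simp: slice_counit_def)
  qed
  have "sq.restricted.monadic"
    using m sq.restricted_monadic adj.monadic_iff by blast
  then have "monadic_adjunction (slice A (Dom A (amap U p))) (slice A (Cod A (amap U p))) (slice_push A (amap U p))
      (slice_map U \<circ>\<^sub>F P \<circ>\<^sub>F slice_section ?b)
      (\<lambda>c. amap (slice_map U) (\<eta> (omap (slice_section ?a) c)))
      (\<lambda>d. amap (slice_map U) (\<epsilon> (omap (slice_section ?b) d)))"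
    unfolding U.amap_Arr[OF \<open>p \<in> Arr X\<close>] by (simp only: sq.restricted.monadic_iff)
  then show "effective_descent A (amap U p)"
    using pullbacks_along_U[OF _ pb] unfolding effective_descent_def by (auto simp del: slice_map_simps slice_section_simps)
qed

end

section \<open>Strict relatively initial objects\<close>

context is_functor
begin

text \<open>
  Initiality in the fibre of \<open>F\<close>, stable under change of base: arrows out of \<open>x\<close> are the same as
  arrows out of its image.
\<close>

definition relatively_initial :: "'o \<Rightarrow> bool" where
  "relatively_initial x \<longleftrightarrow> x \<in> Obj C \<and>
     (\<forall>y \<in> Obj C. \<forall>f \<in> Hom D (omap F x) (omap F y). \<exists>!t. t \<in> Hom C x y \<and> amap F t = f)"

lemma relatively_initial_eq:
  assumes "relatively_initial x" "s \<in> Arr C" "t \<in> Arr C" "Dom C s = x" "Dom C t = x" "Cod C s = Cod C t"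
    "amap F s = amap F t"
  shows "s = t"
proof -
  have "\<exists>!t. t \<in> Hom C x (Cod C s) \<and> amap F t = amap F s"
    using assms by (auto simp: relatively_initial_def in_Hom)
  then show ?thesis using assms by (auto simp: in_Hom)
qed

text \<open>
  The universal property of the objects \<open>zero a\<close> makes \<open>zero\<close> the object part of a left adjoint of
  \<open>F\<close> with identity unit. A relatively initial \<open>x\<close> has an invertible counit, because \<open>x\<close> and
  \<open>zero (F x)\<close> have the same universal property.
\<close>

theorem preserves_effective_descent_if_strict_relatively_initial:
  assumes zero: "\<And>a. a \<in> Obj D \<Longrightarrow> relatively_initial (zero a)"
    and F_zero: "\<And>a. a \<in> Obj D \<Longrightarrow> omap F (zero a) = a"
    and strict: "\<And>x a. \<lbrakk>x \<in> Obj C; a \<in> Obj D; Hom C x (zero a) \<noteq> {}\<rbrakk> \<Longrightarrow> relatively_initial x"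
  shows "preserves_effective_descent C D F"
proof -
  define lift where "lift x y f = (THE t. t \<in> Hom C x y \<and> amap F t = f)" for x y f
  have lift: "lift x y f \<in> Hom C x y \<and> amap F (lift x y f) = f"
    if "relatively_initial x" "y \<in> Obj C" "f \<in> Hom D (omap F x) (omap F y)" for x y f
    unfolding lift_def by (rule theI') (use that in \<open>auto simp: relatively_initial_def\<close>)
  have lift_Arr [simp]: "lift x y f \<in> Arr C" "Dom C (lift x y f) = x" "Cod C (lift x y f) = y"
    "amap F (lift x y f) = f"
    if "relatively_initial x" "y \<in> Obj C" "f \<in> Arr D" "Dom D f = omap F x" "Cod D f = omap F y" for x y f
    using lift[of x y f] that by (auto simp: in_Hom)
  have zero_Obj: "a \<in> Obj D \<Longrightarrow> zero a \<in> Obj C" for a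
    using zero by (auto simp: relatively_initial_def)
  note [simp] = zero F_zero zero_Obj
  define I where "I = \<lparr>omap = zero, amap = (\<lambda>f. lift (zero (Dom D f)) (zero (Cod D f)) f)\<rparr>"
  define \<delta> where "\<delta> x = lift (zero (omap F x)) x (Ident D (omap F x))" for x
  have I [simp]: "omap I = zero" "amap I f = lift (zero (Dom D f)) (zero (Cod D f)) f" for f
    by (auto simp: I_def)
  have I_functor: "is_functor D C I"
    by unfold_locales (auto simp: in_Hom intro!: relatively_initial_eq[OF zero])
  interpret strict_coreflection C D F I \<delta>
  proof (intro strict_coreflection.intro split_coreflection.intro split_coreflection_axioms.intro
      strict_coreflection_axioms.intro is_functor_axioms I_functor)
    fix x a assume x: "x \<in> Obj C" and "a \<in> Obj D" "Hom C x (omap I a) \<noteq> {}"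
    then have rel: "relatively_initial x" using strict by simp
    define e where "e = lift x (zero (omap F x)) (Ident D (omap F x))"
    have "e \<cdot>\<^bsub>C\<^esub> \<delta> x = Ident C (zero (omap F x))"
      by (rule relatively_initial_eq[OF zero[of "omap F x"]]) (use x rel in \<open>auto simp: e_def \<delta>_def\<close>)
    moreover have "\<delta> x \<cdot>\<^bsub>C\<^esub> e = Ident C x"
      by (rule relatively_initial_eq[OF rel]) (use x rel in \<open>auto simp: e_def \<delta>_def\<close>)
    ultimately show "iso_arrow C (\<delta> x)"
      using x rel by (auto simp: iso_arrow_def in_Hom e_def \<delta>_def intro!: bexI[of _ e])
  qed (auto simp: \<delta>_def in_Hom intro!: relatively_initial_eq[OF zero])
  show ?thesis by (rule preserves_effective_descent)
qed

end

section \<open>The Grothendieck construction\<close>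

lemma (in category) initial_if_iso:
  assumes "isomorphic C x z" "initial C z"
  shows "initial C x"
proof -
  obtain f g where f: "f \<in> Hom C x z" and fg: "inverse_arrows C f g"
    using assms(1) unfolding isomorphic_def iso_arrow_inverse by blast
  note [simp] = f[unfolded in_Hom]
  have g [simp]: "g \<in> Arr C" "Dom C g = z" "Cod C g = x" "g \<cdot>\<^bsub>C\<^esub> f = Ident C x"
    using fg by (auto simp: inverse_arrows_def in_Hom)
  have x: "x \<in> Obj C" using Dom_in[of f] by simp
  have "\<exists>!h. h \<in> Hom C x y" if "y \<in> Obj C" for y
  proof -
    have "\<exists>!k. k \<in> Hom C z y" using assms(2) that by (simp add: initial_def)
    then obtain k where k: "k \<in> Hom C z y" and unique: "\<And>k'. k' \<in> Hom C z y \<Longrightarrow> k' = k" by blast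
    show ?thesis
    proof (rule ex1I)
      show "k \<cdot>\<^bsub>C\<^esub> f \<in> Hom C x y" using k by (simp add: in_Hom)
    next
      fix h assume h: "h \<in> Hom C x y"
      have "h \<cdot>\<^bsub>C\<^esub> g = k" by (rule unique) (use h in \<open>simp add: in_Hom\<close>)
      then have "(h \<cdot>\<^bsub>C\<^esub> g) \<cdot>\<^bsub>C\<^esub> f = k \<cdot>\<^bsub>C\<^esub> f" by simp
      then show "h = k \<cdot>\<^bsub>C\<^esub> f" using h by (simp add: in_Hom)
    qed
  qed
  then show ?thesis using x by (auto simp: initial_def)
qed

context pseudofunctor
begin

text \<open>
  The unit laws are the unit coherences of the pseudofunctor. For associativity, both composites
  are rearranged to share the compositor of \<open>g \<cdot> f\<close> with \<open>h\<close>: the left one by the associativity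
  coherence, followed by naturality of the compositor of \<open>f\<close> with \<open>g\<close>.
\<close>

lemma category_grothendieck: "category (grothendieck A F)"
  unfolding grothendieck_def
proof (rule category_hom_category; clarify)
  fix a x assume a: "a \<in> Obj A" and x: "x \<in> Obj (fibre F a)"
  interpret u: nat_iso "fibre F a" "fibre F a" fctr_id "reindex F (Ident A a)" "unitor F a"
    using a by (rule unitor_iso)
  show "Ident A a \<in> Hom A a a \<and> unitor F a x \<in> Hom (fibre F a) x (omap (reindex F (Ident A a)) x)"
    using a x by (simp add: in_Hom)
next
  fix a x b y c z f \<phi> g \<psi>
  assume ab: "f \<in> Hom A a b" and bc: "g \<in> Hom A b c"
    and x: "x \<in> Obj (fibre F a)" and y: "y \<in> Obj (fibre F b)" and z: "z \<in> Obj (fibre F c)"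
    and \<phi>: "\<phi> \<in> Hom (fibre F a) x (omap (reindex F f) y)"
    and \<psi>: "\<psi> \<in> Hom (fibre F b) y (omap (reindex F g) z)"
  interpret f: is_functor "fibre F b" "fibre F a" "reindex F f" using ab by (rule reindex_functor)
  interpret c: nat_iso "fibre F c" "fibre F a" "reindex F f \<circ>\<^sub>F reindex F g" "reindex F (g \<cdot>\<^bsub>A\<^esub> f)" "compositor F f g"
    using ab bc by (rule compositor_iso)
  show "g \<cdot>\<^bsub>A\<^esub> f \<in> Hom A a c \<and>
      compositor F f g z \<cdot>\<^bsub>fibre F a\<^esub> (amap (reindex F f) \<psi> \<cdot>\<^bsub>fibre F a\<^esub> \<phi>)
        \<in> Hom (fibre F a) x (omap (reindex F (g \<cdot>\<^bsub>A\<^esub> f)) z)"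
    using ab bc z \<phi> \<psi> by (simp add: in_Hom)
next
  fix a x b y f \<phi>
  assume a: "a \<in> Obj A" and ab: "f \<in> Hom A a b" and y: "y \<in> Obj (fibre F b)"
    and \<phi>: "\<phi> \<in> Hom (fibre F a) x (omap (reindex F f) y)"
  interpret f: is_functor "fibre F b" "fibre F a" "reindex F f" using ab by (rule reindex_functor)
  interpret u: nat_iso "fibre F a" "fibre F a" fctr_id "reindex F (Ident A a)" "unitor F a"
    using a by (rule unitor_iso)
  interpret c: nat_iso "fibre F b" "fibre F a" "reindex F (Ident A a) \<circ>\<^sub>F reindex F f"
    "reindex F (f \<cdot>\<^bsub>A\<^esub> Ident A a)" "compositor F (Ident A a) f"
    using A.Ident_in[OF a] ab by (rule compositor_iso)
  have "compositor F (Ident A a) f y \<cdot>\<^bsub>fibre F a\<^esub> unitor F a (omap (reindex F f) y) \<cdot>\<^bsub>fibre F a\<^esub> \<phi>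
      = (compositor F (Ident A a) f y \<cdot>\<^bsub>fibre F a\<^esub> unitor F a (omap (reindex F f) y)) \<cdot>\<^bsub>fibre F a\<^esub> \<phi>"
    using y \<phi> by (simp add: in_Hom)
  then show "f \<cdot>\<^bsub>A\<^esub> Ident A a = f \<and>
      compositor F (Ident A a) f y \<cdot>\<^bsub>fibre F a\<^esub> (amap (reindex F (Ident A a)) \<phi> \<cdot>\<^bsub>fibre F a\<^esub> unitor F a x) = \<phi>"
    unfolding coherence_unit_left[OF ab y] using ab \<phi> u.natural[of \<phi>] by (simp add: in_Hom)
next
  fix a x b y f \<phi>
  assume b: "b \<in> Obj A" and ab: "f \<in> Hom A a b" and y: "y \<in> Obj (fibre F b)"
    and \<phi>: "\<phi> \<in> Hom (fibre F a) x (omap (reindex F f) y)"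
  interpret f: is_functor "fibre F b" "fibre F a" "reindex F f" using ab by (rule reindex_functor)
  interpret u: nat_iso "fibre F b" "fibre F b" fctr_id "reindex F (Ident A b)" "unitor F b"
    using b by (rule unitor_iso)
  interpret c: nat_iso "fibre F b" "fibre F a" "reindex F f \<circ>\<^sub>F reindex F (Ident A b)"
    "reindex F (Ident A b \<cdot>\<^bsub>A\<^esub> f)" "compositor F f (Ident A b)"
    using ab A.Ident_in[OF b] by (rule compositor_iso)
  have "compositor F f (Ident A b) y \<cdot>\<^bsub>fibre F a\<^esub> amap (reindex F f) (unitor F b y) \<cdot>\<^bsub>fibre F a\<^esub> \<phi>
      = (compositor F f (Ident A b) y \<cdot>\<^bsub>fibre F a\<^esub> amap (reindex F f) (unitor F b y)) \<cdot>\<^bsub>fibre F a\<^esub> \<phi>"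
    using y \<phi> by (simp add: in_Hom)
  then show "Ident A b \<cdot>\<^bsub>A\<^esub> f = f \<and>
      compositor F f (Ident A b) y \<cdot>\<^bsub>fibre F a\<^esub> (amap (reindex F f) (unitor F b y) \<cdot>\<^bsub>fibre F a\<^esub> \<phi>) = \<phi>"
    unfolding coherence_unit_right[OF ab y] using ab \<phi> by (simp add: in_Hom)
next
  fix a x b y c z d w f \<phi> g \<psi> h \<chi>
  assume ab: "f \<in> Hom A a b" and bc: "g \<in> Hom A b c" and cd: "h \<in> Hom A c d"
    and z: "z \<in> Obj (fibre F c)" and w: "w \<in> Obj (fibre F d)"
    and \<phi>: "\<phi> \<in> Hom (fibre F a) x (omap (reindex F f) y)"
    and \<psi>: "\<psi> \<in> Hom (fibre F b) y (omap (reindex F g) z)"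
    and \<chi>: "\<chi> \<in> Hom (fibre F c) z (omap (reindex F h) w)"
  note ac = A.Compose_in[OF ab bc] and bd = A.Compose_in[OF bc cd]
  interpret f: is_functor "fibre F b" "fibre F a" "reindex F f" using ab by (rule reindex_functor)
  interpret g: is_functor "fibre F c" "fibre F b" "reindex F g" using bc by (rule reindex_functor)
  interpret h: is_functor "fibre F d" "fibre F c" "reindex F h" using cd by (rule reindex_functor)
  interpret fg: nat_iso "fibre F c" "fibre F a" "reindex F f \<circ>\<^sub>F reindex F g" "reindex F (g \<cdot>\<^bsub>A\<^esub> f)" "compositor F f g"
    using ab bc by (rule compositor_iso)
  interpret gh: nat_iso "fibre F d" "fibre F b" "reindex F g \<circ>\<^sub>F reindex F h" "reindex F (h \<cdot>\<^bsub>A\<^esub> g)" "compositor F g h"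
    using bc cd by (rule compositor_iso)
  interpret f_gh: nat_iso "fibre F d" "fibre F a" "reindex F f \<circ>\<^sub>F reindex F (h \<cdot>\<^bsub>A\<^esub> g)"
    "reindex F ((h \<cdot>\<^bsub>A\<^esub> g) \<cdot>\<^bsub>A\<^esub> f)" "compositor F f (h \<cdot>\<^bsub>A\<^esub> g)"
    using ab bd by (rule compositor_iso)
  interpret fg_h: nat_iso "fibre F d" "fibre F a" "reindex F (g \<cdot>\<^bsub>A\<^esub> f) \<circ>\<^sub>F reindex F h"
    "reindex F (h \<cdot>\<^bsub>A\<^esub> g \<cdot>\<^bsub>A\<^esub> f)" "compositor F (g \<cdot>\<^bsub>A\<^esub> f) h"
    using ac cd by (rule compositor_iso)
  note hom = \<phi>[unfolded in_Hom] \<psi>[unfolded in_Hom] \<chi>[unfolded in_Hom]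
  have assoc_A: "(h \<cdot>\<^bsub>A\<^esub> g) \<cdot>\<^bsub>A\<^esub> f = h \<cdot>\<^bsub>A\<^esub> g \<cdot>\<^bsub>A\<^esub> f" using ab bc cd by (rule A.Compose_assoc)
  let ?r = "amap (reindex F f) (amap (reindex F g) \<chi>) \<cdot>\<^bsub>fibre F a\<^esub> amap (reindex F f) \<psi> \<cdot>\<^bsub>fibre F a\<^esub> \<phi>"
  have "compositor F f (h \<cdot>\<^bsub>A\<^esub> g) w \<cdot>\<^bsub>fibre F a\<^esub>
        (amap (reindex F f) (compositor F g h w \<cdot>\<^bsub>fibre F b\<^esub> (amap (reindex F g) \<chi> \<cdot>\<^bsub>fibre F b\<^esub> \<psi>)) \<cdot>\<^bsub>fibre F a\<^esub> \<phi>)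
      = (compositor F f (h \<cdot>\<^bsub>A\<^esub> g) w \<cdot>\<^bsub>fibre F a\<^esub> amap (reindex F f) (compositor F g h w)) \<cdot>\<^bsub>fibre F a\<^esub> ?r"
    using w hom by simp
  also have "\<dots> = compositor F (g \<cdot>\<^bsub>A\<^esub> f) h w \<cdot>\<^bsub>fibre F a\<^esub>
      (compositor F f g (omap (reindex F h) w) \<cdot>\<^bsub>fibre F a\<^esub> amap (reindex F f) (amap (reindex F g) \<chi>)) \<cdot>\<^bsub>fibre F a\<^esub>
      amap (reindex F f) \<psi> \<cdot>\<^bsub>fibre F a\<^esub> \<phi>"
    unfolding coherence_assoc[OF ab bc cd w] using w hom by simp
  also have "compositor F f g (omap (reindex F h) w) \<cdot>\<^bsub>fibre F a\<^esub> amap (reindex F f) (amap (reindex F g) \<chi>)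
      = amap (reindex F (g \<cdot>\<^bsub>A\<^esub> f)) \<chi> \<cdot>\<^bsub>fibre F a\<^esub> compositor F f g z"
    using fg.natural[of \<chi>] hom by simp
  finally show "(h \<cdot>\<^bsub>A\<^esub> g) \<cdot>\<^bsub>A\<^esub> f = h \<cdot>\<^bsub>A\<^esub> g \<cdot>\<^bsub>A\<^esub> f \<and>
      compositor F f (h \<cdot>\<^bsub>A\<^esub> g) w \<cdot>\<^bsub>fibre F a\<^esub>
        (amap (reindex F f) (compositor F g h w \<cdot>\<^bsub>fibre F b\<^esub> (amap (reindex F g) \<chi> \<cdot>\<^bsub>fibre F b\<^esub> \<psi>)) \<cdot>\<^bsub>fibre F a\<^esub> \<phi>)
      = compositor F (g \<cdot>\<^bsub>A\<^esub> f) h w \<cdot>\<^bsub>fibre F a\<^esub>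
        (amap (reindex F (g \<cdot>\<^bsub>A\<^esub> f)) \<chi> \<cdot>\<^bsub>fibre F a\<^esub>
          (compositor F f g z \<cdot>\<^bsub>fibre F a\<^esub> (amap (reindex F f) \<psi> \<cdot>\<^bsub>fibre F a\<^esub> \<phi>)))"
    using assoc_A z hom by simp
qed

lemma Obj_grothendieck: "Obj (grothendieck A F) = (SIGMA a:Obj A. Obj (fibre F a))"
  by (simp add: grothendieck_def hom_category_simps)

lemma Hom_grothendieck:
  assumes "(a, x) \<in> Obj (grothendieck A F)" "(b, y) \<in> Obj (grothendieck A F)"
  shows "Hom (grothendieck A F) (a, x) (b, y)
     = {Tag (a, x) (f, \<phi>) (b, y) | f \<phi>. f \<in> Hom A a b \<and> \<phi> \<in> Hom (fibre F a) x (omap (reindex F f) y)}"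
  using assms unfolding Obj_grothendieck unfolding grothendieck_def Hom_hom_category by auto

lemma grothendieck_proj_functor: "is_functor (grothendieck A F) A (grothendieck_proj F)"
proof (intro is_functor.intro is_functor_axioms.intro category_grothendieck A.category_axioms)
  let ?X = "grothendieck A F" and ?U = "grothendieck_proj F"
  interpret X: category ?X by (rule category_grothendieck)
  show "omap ?U x \<in> Obj A" "amap ?U (Ident ?X x) = Ident A (omap ?U x)" if "x \<in> Obj ?X" for x
    using that by (auto simp: grothendieck_proj_def Obj_grothendieck) (auto simp: grothendieck_def hom_category_simps)
  have Arr: "\<exists>a x b y f \<phi>. t = Tag (a, x) (f, \<phi>) (b, y) \<and> s = (a, x) \<and> s' = (b, y) \<and> f \<in> Hom A a b"
    if "t \<in> Hom ?X s s'" for t s s'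
  proof -
    have "s \<in> Obj ?X" "s' \<in> Obj ?X" using that X.Dom_in[of t] X.Cod_in[of t] by (auto simp: in_Hom)
    then show ?thesis using that by (cases s; cases s') (auto simp: Hom_grothendieck)
  qed
  show "amap ?U t \<in> Hom A (omap ?U x) (omap ?U y)" if "t \<in> Hom ?X x y" for t x y
    using Arr[OF that] by (auto simp: grothendieck_proj_def)
  show "amap ?U (t \<cdot>\<^bsub>?X\<^esub> s) = amap ?U t \<cdot>\<^bsub>A\<^esub> amap ?U s" if "s \<in> Hom ?X x y" "t \<in> Hom ?X y z" for s t x y z
    using Arr[OF that(1)] Arr[OF that(2)]
    by (auto simp: grothendieck_proj_def grothendieck_def hom_category_simps)
qed

text \<open>
  An arrow from \<open>(a, x)\<close> to \<open>(b, y)\<close> over \<open>f\<close> is an arrow of the fibre over \<open>a\<close> from \<open>x\<close> to the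
  reindexing of \<open>y\<close>.
\<close>

lemma relatively_initial_grothendieck:
  assumes "a \<in> Obj A" "initial (fibre F a) x"
  shows "is_functor.relatively_initial (grothendieck A F) A (grothendieck_proj F) (a, x)"
proof -
  interpret U: is_functor "grothendieck A F" A "grothendieck_proj F" by (rule grothendieck_proj_functor)
  have ax: "(a, x) \<in> Obj (grothendieck A F)" using assms by (simp add: Obj_grothendieck initial_def)
  have "\<exists>!t. t \<in> Hom (grothendieck A F) (a, x) (b, y) \<and> amap (grothendieck_proj F) t = f"
    if by': "(b, y) \<in> Obj (grothendieck A F)" and f: "f \<in> Hom A a b" for b y f
  proof -
    interpret f: is_functor "fibre F b" "fibre F a" "reindex F f" using f by (rule reindex_functor)
    have "\<exists>!\<phi>. \<phi> \<in> Hom (fibre F a) x (omap (reindex F f) y)"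
      using assms(2) by' by (simp add: initial_def Obj_grothendieck)
    then obtain \<phi> where \<phi>: "\<phi> \<in> Hom (fibre F a) x (omap (reindex F f) y)"
      and unique: "\<And>\<psi>. \<psi> \<in> Hom (fibre F a) x (omap (reindex F f) y) \<Longrightarrow> \<psi> = \<phi>"
      by blast
    show ?thesis
    proof (rule ex1I[of _ "Tag (a, x) (f, \<phi>) (b, y)"])
      show "Tag (a, x) (f, \<phi>) (b, y) \<in> Hom (grothendieck A F) (a, x) (b, y) \<and>
          amap (grothendieck_proj F) (Tag (a, x) (f, \<phi>) (b, y)) = f"
        using f \<phi> by (simp add: Hom_grothendieck[OF ax by'] grothendieck_proj_def)
    next
      fix t assume "t \<in> Hom (grothendieck A F) (a, x) (b, y) \<and> amap (grothendieck_proj F) t = f"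
      then obtain \<psi> where "t = Tag (a, x) (f, \<psi>) (b, y)" "\<psi> \<in> Hom (fibre F a) x (omap (reindex F f) y)"
        by (auto simp: Hom_grothendieck[OF ax by'] grothendieck_proj_def)
      then show "t = Tag (a, x) (f, \<phi>) (b, y)" using unique by blast
    qed
  qed
  then have "\<exists>!t. t \<in> Hom (grothendieck A F) (a, x) y \<and> amap (grothendieck_proj F) t = f"
    if "y \<in> Obj (grothendieck A F)" "f \<in> Hom A a (fst y)" for y f
    using that by (cases y) simp
  then show ?thesis
    using ax unfolding U.relatively_initial_def by (simp add: grothendieck_proj_def)
qed

end

text \<open>
  If \<open>(a, x)\<close> maps to \<open>(c, 0\<^sub>c)\<close> over \<open>f\<close>, then \<open>x\<close> maps to the reindexing of \<open>0\<^sub>c\<close> along \<open>f\<close>, which is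
  initial and so maps to \<open>0\<^sub>a\<close>. By strictness \<open>x\<close> is initial.
\<close>

theorem theorem15:
  fixes A :: "('a, 'f) cat" and F :: "('a, 'f, 'x, 'y) psfctr"
  assumes "category A"
    and "pseudofunctor A F"
    and "\<And>a. a \<in> Obj A \<Longrightarrow> \<exists>z. strict_initial (fibre F a) z"
    and "\<And>a b f. f \<in> Hom A a b \<Longrightarrow>
      preserves_initial_objects (fibre F b) (fibre F a) (reindex F f)"
  shows "preserves_effective_descent (grothendieck A F) A (grothendieck_proj F)"
proof -
  interpret pseudofunctor A F by fact
  interpret U: is_functor "grothendieck A F" A "grothendieck_proj F" by (rule grothendieck_proj_functor)
  obtain z where z: "\<And>a. a \<in> Obj A \<Longrightarrow> strict_initial (fibre F a) (z a)"
    using assms(3) by metis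
  show ?thesis
  proof (rule U.preserves_effective_descent_if_strict_relatively_initial[where zero = "\<lambda>a. (a, z a)"])
    show "U.relatively_initial (a, z a)" if "a \<in> Obj A" for a
      using relatively_initial_grothendieck[OF that] z[OF that] by (simp add: strict_initial_def)
    show "omap (grothendieck_proj F) (a, z a) = a" for a by (simp add: grothendieck_proj_def)
  next
    fix X c assume X: "X \<in> Obj (grothendieck A F)" and c: "c \<in> Obj A" and hom: "Hom (grothendieck A F) X (c, z c) \<noteq> {}"
    obtain a x where ax: "X = (a, x)" "a \<in> Obj A" "x \<in> Obj (fibre F a)" using X by (auto simp: Obj_grothendieck)
    have "(c, z c) \<in> Obj (grothendieck A F)"
      using c z[OF c] by (simp add: Obj_grothendieck strict_initial_def initial_def)
    then obtain f \<phi> where f: "f \<in> Hom A a c" and \<phi>: "\<phi> \<in> Hom (fibre F a) x (omap (reindex F f) (z c))"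
      using hom X unfolding ax by (auto simp: Hom_grothendieck)
    interpret fibre: category "fibre F a" using ax(2) by (rule fibre_category)
    have "initial (fibre F a) (omap (reindex F f) (z c))"
      using assms(4)[OF f] z[OF c] by (simp add: preserves_initial_objects_def strict_initial_def)
    moreover have "z a \<in> Obj (fibre F a)"
      using z[OF ax(2)] by (simp add: strict_initial_def initial_def)
    ultimately have "\<exists>!k. k \<in> Hom (fibre F a) (omap (reindex F f) (z c)) (z a)"
      by (simp add: initial_def)
    then obtain k where "k \<in> Hom (fibre F a) (omap (reindex F f) (z c)) (z a)" by blast
    then have "Hom (fibre F a) x (z a) \<noteq> {}" using fibre.Compose_in[OF \<phi>] by blast
    then have "isomorphic (fibre F a) x (z a)" using z[OF ax(2)] ax(3) by (simp add: strict_initial_def)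
    then have "initial (fibre F a) x" using z[OF ax(2)] fibre.initial_if_iso by (simp add: strict_initial_def)
    then show "U.relatively_initial X" unfolding ax(1) by (rule relatively_initial_grothendieck[OF ax(2)])
  qed
qed

end
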